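(* Let $j:H_1\to H_2$ be a homomorphism between finite groups, and consider a $j$-equivariant linear map $\phi:V_1\to V_2$, where $V_i$ is a $\mathbb{Q}H_i$-module. If $\phi(V_1)$ generates $V_2$ as a $\mathbb{Q}H_2$-module, then the averaging map $$V_1^{H_1}\to V_2^{H_2},\qquad v\mapsto\overline{\phi(v)},$$ is surjective. Consequently, if $V$ is a finitely generated $\mathrm{FI}_W$-module over a field of characteristic zero, and $V$ is generated in stage $d$ and has stable range $n\ge N$, then the averaging map $V_n^{W_n}\to V_{n+1}^{W_{n+1}}$ is surjective for $n\ge d$ and is an isomorphism for $n\ge N$. Moreover, if $V$ is a finitely generated $\mathrm{FI}_W\#$-module over a field of characteristic zero, and $V$ is generated in stage $d$, then the averaging map $V_n^{W_n}\to V_{n+1}^{W_{n+1}}$ is an isomorphism for $n\ge d$.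
   Context: For a finite group $H$ and an $H$-representation $V$ over a field of characteristic zero, $V^H$ is the subspace of invariants and $\overline{v}=\frac1{|H|}\sum_{h\in H}h\cdot v\in V^H$. The map $\phi$ is $j$-equivariant if $\phi(h\cdot v)=j(h)\cdot\phi(v)$. For an $\mathrm{FI}_W$-module the averaging map is $v\mapsto\overline{V(i_n)(v)}$ (averaging over $W_{n+1}$). Weyl groups: $W_n=S_n$ in type A; $W_n=B_n=\mathbb{Z}_2\wr S_n$ (permutations $\sigma$ of $\mathbf{n}=\{\pm1,\dots,\pm n\}$ with $\sigma(-t)=-\sigma(t)$) in types B, C; $W_n=D_n\le B_n$, the index-2 subgroup of signed permutations reversing an even number of signs, in type D. $\mathrm{FI}_{BC}=\mathrm{FI}_B=\mathrm{FI}_C$ is the category with objects $\mathbf{n}=\{\pm1,\dots,\pm n\}$ ($\mathbf{0}=\emptyset$) and morphisms the injections $\phi:\mathbf{m}\to\mathbf{n}$ with $\phi(-t)=-\phi(t)$. $\mathrm{FI}_A$ is the subcategory of sign-preserving morphisms; $\mathrm{FI}_D$ is the subcategory in which isomorphisms must reverse an even number of signs. $\mathrm{FI}_W$ is any of these three. An $\mathrm{FI}_W$-module over a field $\mathbf{k}$ is a functor $V:\mathrm{FI}_W\to\mathbf{k}\text{-Mod}$; $V_n=V(\mathbf{n})$ is a $W_n$-representation. Let $i_n:\mathbf{n}\to\mathbf{n+1}$, $i_n(j)=j$. $V$ is generated in stage $d$ if for every $m\ge d$ the images of $V_d$ under all morphisms $\mathbf{d}\to\mathbf{m}$ span $V_m$;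 finitely generated if moreover $V_d$ is finite-dimensional, for some such $d$. $\mathrm{FI}_{BC}\#$ has objects the based sets $\mathbf{n}_0=\mathbf{n}\cup\{0\}$ and morphisms the based maps $\phi:\mathbf{n}_0\to\mathbf{m}_0$ injective on $\mathbf{n}\setminus\phi^{-1}(0)$ with $\phi(\{i,-i\})=\{\phi(i),-\phi(i)\}$ ($-0=0$). $\mathrm{FI}_A\#$ is the subcategory of morphisms with $\phi(i)\in\{0,\dots,m\}$ for $i\in\{1,\dots,n\}$. $\mathrm{FI}_W\#$ is one of these two (types A, B, C only). An $\mathrm{FI}_W\#$-module is a functor to vector spaces; it has an underlying $\mathrm{FI}_W$-module (restriction along $\mathbf{n}\mapsto\mathbf{n}_0$, extending morphisms by $0\mapsto 0$), to which "finitely generated" and "generated in stage $d$" refer. Stable range: for a partition $\lambda$ of $m$ and $n\ge m+\lambda_1$ let $\lambda[n]=(n-m,\lambda_1,\lambda_2,\dots)$; in type A, $V(\lambda)_n$ is the irreducible $S_n$-representation of $\lambda[n]$. For a double partition $\lambda=(\lambda^+,\lambda^-)$ of $m$ (i.e. $|\lambda^+|+|\lambda^-|=m$) and $n\ge m+\lambda^+_1$, let $\lambda[n]=((n-m,\lambda^+),\lambda^-)$; in types B, C, $V(\lambda)_n$ is the irreducible $B_n$-representation of $\lambda[n]$ (irreducible $B_n$-representations being indexed by double partitions of $n$, with $((n),\emptyset)$ the trivial one); in type D it is the restriction of this representation to $D_n$. $V$ is uniformly representation stable with stable range $n\ge N$ if (I) $V(i_n)$ is injective for all large $n$; (II) the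 image of $V(i_n)$ generates $V_{n+1}$ as a $\mathbf{k}[W_{n+1}]$-module for all large $n$; (III) for all large $n$ there is a decomposition $V_n\cong\bigoplus_\lambda c_{\lambda,n}V(\lambda)_n$ and, for every $\lambda$, $c_{\lambda,n}$ is constant for all $n\ge N$, with $N$ independent of $\lambda$. (Finitely generated $\mathrm{FI}_W$-modules over fields of characteristic zero are uniformly representation stable.)
   Formalization: The isomorphism for n ≥ N is stated for n ≥ N with also n ≥ d, and in type D at n = N > 0 only if the multiplicity of the label (∅,(N)) in V_N is zero; without these conditions the claim is false. *)

theory Defs
  imports Complex_Main "HOL-Algebra.Group" "HOL-Combinatorics.Permutations" "HOL-Library.Function_Algebras"
begin

section \<open>Representations\<close>

text \<open>
  Vector spaces are carried by a subspace \<open>U\<close> of an ambient space \<open>'v\<close>, so that the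
  infinitely many spaces of a functor can share one HOL type. This is no restriction: any
  sequence of spaces embeds in its direct sum.
\<close>

definition linear_on ::
  "('k::field \<Rightarrow> 'v::ab_group_add \<Rightarrow> 'v) \<Rightarrow> ('k \<Rightarrow> 'w::ab_group_add \<Rightarrow> 'w)
    \<Rightarrow> 'v set \<Rightarrow> 'w set \<Rightarrow> ('v \<Rightarrow> 'w) \<Rightarrow> bool"
  where "linear_on s1 s2 U W f \<longleftrightarrow>
    f \<in> U \<rightarrow> W \<and> (\<forall>x\<in>U. \<forall>y\<in>U. f (x + y) = f x + f y) \<and> (\<forall>a. \<forall>x\<in>U. f (s1 a x) = s2 a (f x))"

definition linear_iso_on ::
  "('k::field \<Rightarrow> 'v::ab_group_add \<Rightarrow> 'v) \<Rightarrow> ('k \<Rightarrow> 'w::ab_group_add \<Rightarrow> 'w)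
    \<Rightarrow> 'v set \<Rightarrow> 'w set \<Rightarrow> ('v \<Rightarrow> 'w) \<Rightarrow> bool"
  where "linear_iso_on s1 s2 U W f \<longleftrightarrow> linear_on s1 s2 U W f \<and> bij_betw f U W"

locale group_rep = group G + vector_space scale
  for G :: "('g, 'm) monoid_scheme" (structure)
    and scale :: "'k::field \<Rightarrow> 'v::ab_group_add \<Rightarrow> 'v" +
  fixes U :: "'v set" and \<rho> :: "'g \<Rightarrow> 'v \<Rightarrow> 'v"
  assumes carrier_subspace: "subspace U"
    and act_linear: "g \<in> carrier G \<Longrightarrow> linear_on scale scale U U (\<rho> g)"
    and act_one: "v \<in> U \<Longrightarrow> \<rho> \<one> v = v"
    and act_mult: "\<lbrakk>g \<in> carrier G; h \<in> carrier G; v \<in> U\<rbrakk> \<Longrightarrow> \<rho> (g \<otimes> h) v = \<rho> g (\<rho> h v)"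

definition equivariant ::
  "('g, 'm) monoid_scheme \<Rightarrow> ('g \<Rightarrow> 'h) \<Rightarrow> 'v set \<Rightarrow> ('g \<Rightarrow> 'v \<Rightarrow> 'v) \<Rightarrow> ('h \<Rightarrow> 'w \<Rightarrow> 'w)
    \<Rightarrow> ('v \<Rightarrow> 'w) \<Rightarrow> bool"
  where "equivariant G j U \<rho> \<sigma> f \<longleftrightarrow> (\<forall>g\<in>carrier G. \<forall>v\<in>U. f (\<rho> g v) = \<sigma> (j g) (f v))"

definition rep_isomorphic ::
  "('g, 'm) monoid_scheme \<Rightarrow> ('k::field \<Rightarrow> 'v::ab_group_add \<Rightarrow> 'v) \<Rightarrow> 'v set \<Rightarrow> ('g \<Rightarrow> 'v \<Rightarrow> 'v)
    \<Rightarrow> ('k \<Rightarrow> 'w::ab_group_add \<Rightarrow> 'w) \<Rightarrow> 'w set \<Rightarrow> ('g \<Rightarrow> 'w \<Rightarrow> 'w) \<Rightarrow> bool"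
  where "rep_isomorphic G s1 U \<rho> s2 W \<sigma> \<longleftrightarrow>
    (\<exists>f. linear_iso_on s1 s2 U W f \<and> equivariant G (\<lambda>g. g) U \<rho> \<sigma> f)"

definition invariants :: "('g, 'm) monoid_scheme \<Rightarrow> 'v set \<Rightarrow> ('g \<Rightarrow> 'v \<Rightarrow> 'v) \<Rightarrow> 'v set"
  where "invariants G U \<rho> = {v \<in> U. \<forall>g\<in>carrier G. \<rho> g v = v}"

definition average ::
  "('g, 'm) monoid_scheme \<Rightarrow> ('k::field \<Rightarrow> 'v::ab_group_add \<Rightarrow> 'v) \<Rightarrow> ('g \<Rightarrow> 'v \<Rightarrow> 'v) \<Rightarrow> 'v \<Rightarrow> 'v"
  where "average G scale \<rho> v = scale (1 / of_nat (card (carrier G))) (\<Sum>g\<in>carrier G. \<rho> g v)"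

text \<open>The sub-\<open>k[G]\<close>-module generated by \<open>S\<close>.\<close>

definition group_span ::
  "('g, 'm) monoid_scheme \<Rightarrow> ('k::field \<Rightarrow> 'v::ab_group_add \<Rightarrow> 'v) \<Rightarrow> ('g \<Rightarrow> 'v \<Rightarrow> 'v) \<Rightarrow> 'v set \<Rightarrow> 'v set"
  where "group_span G scale \<rho> S = module.span scale (\<Union>g\<in>carrier G. \<rho> g ` S)"

definition direct_sum :: "'i set \<Rightarrow> ('i \<Rightarrow> 'v::ab_group_add set) \<Rightarrow> ('i \<Rightarrow> 'v) set"
  where "direct_sum I U =
    {f. (\<forall>i\<in>I. f i \<in> U i) \<and> (\<forall>i. i \<notin> I \<longrightarrow> f i = 0) \<and> finite {i. f i \<noteq> 0}}"

definition direct_sum_scale :: "('k \<Rightarrow> 'v \<Rightarrow> 'v) \<Rightarrow> 'k \<Rightarrow> ('i \<Rightarrow> 'v) \<Rightarrow> ('i \<Rightarrow> 'v)"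
  where "direct_sum_scale scale a f = (\<lambda>i. scale a (f i))"

definition direct_sum_act :: "('g \<Rightarrow> 'v \<Rightarrow> 'v) \<Rightarrow> 'g \<Rightarrow> ('i \<Rightarrow> 'v) \<Rightarrow> ('i \<Rightarrow> 'v)"
  where "direct_sum_act \<rho> g f = (\<lambda>i. \<rho> g (f i))"


section \<open>The categories \<open>FI\<^sub>W\<close> and \<open>FI\<^sub>W#\<close>\<close>

text \<open>The types B and C have the same Weyl groups and the same categories.\<close>

datatype weyl_type = TypeA | TypeBC | TypeD

definition signed :: "nat \<Rightarrow> int set"
  where "signed n = {t. t \<noteq> 0 \<and> \<bar>t\<bar> \<le> int n}"

text \<open>
  A morphism out of \<open>signed m\<close> is a function on the integers vanishing off \<open>signed m\<close>. So a
  morphism of \<open>FI\<^sub>W\<close> is literally equal to its extension by \<open>0 \<mapsto> 0\<close> in \<open>FI\<^sub>W#\<close>, and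
  composition is composition of functions. Source and target are not recorded in the function;
  \<open>id_incl m\<close> is both the identity of \<open>m\<close> and the inclusion of \<open>m\<close> in any \<open>n \<ge> m\<close>.
\<close>

definition id_incl :: "nat \<Rightarrow> int \<Rightarrow> int"
  where "id_incl n t = (if t \<in> signed n then t else 0)"

definition FI_BC_hom :: "nat \<Rightarrow> nat \<Rightarrow> (int \<Rightarrow> int) set"
  where "FI_BC_hom m n =
    {\<phi>. (\<forall>t. t \<notin> signed m \<longrightarrow> \<phi> t = 0) \<and> \<phi> ` signed m \<subseteq> signed n \<and> inj_on \<phi> (signed m)
      \<and> (\<forall>t\<in>signed m. \<phi> (- t) = - \<phi> t)}"

definition FI_hom :: "weyl_type \<Rightarrow> nat \<Rightarrow> nat \<Rightarrow> (int \<Rightarrow> int) set"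
  where "FI_hom W m n = (case W of
      TypeA \<Rightarrow> {\<phi> \<in> FI_BC_hom m n. \<forall>t\<in>signed m. sgn (\<phi> t) = sgn t}
    | TypeBC \<Rightarrow> FI_BC_hom m n
    | TypeD \<Rightarrow> {\<phi> \<in> FI_BC_hom m n. bij_betw \<phi> (signed m) (signed n) \<longrightarrow>
                   even (card {t \<in> {1..int m}. \<phi> t < 0})})"

definition FI_BC_sharp_hom :: "nat \<Rightarrow> nat \<Rightarrow> (int \<Rightarrow> int) set"
  where "FI_BC_sharp_hom m n =
    {\<phi>. (\<forall>t. t \<notin> signed m \<longrightarrow> \<phi> t = 0) \<and> \<phi> ` insert 0 (signed m) \<subseteq> insert 0 (signed n)
      \<and> inj_on \<phi> (signed m - \<phi> -` {0}) \<and> (\<forall>t\<in>signed m. \<phi> ` {t, - t} = {\<phi> t, - \<phi> t})}"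

text \<open>There is no \<open>FI\<^sub>D#\<close>; the value at \<^const>\<open>TypeD\<close> is irrelevant.\<close>

definition FI_sharp_hom :: "weyl_type \<Rightarrow> nat \<Rightarrow> nat \<Rightarrow> (int \<Rightarrow> int) set"
  where "FI_sharp_hom W m n = (if W = TypeA
    then {\<phi> \<in> FI_BC_sharp_hom m n. \<forall>t\<in>{1..int m}. \<phi> t \<in> {0..int n}}
    else FI_BC_sharp_hom m n)"

definition weyl_group :: "weyl_type \<Rightarrow> nat \<Rightarrow> (int \<Rightarrow> int) monoid"
  where "weyl_group W n = \<lparr>carrier = FI_hom W n n, monoid.mult = (\<circ>), one = id_incl n\<rparr>"

text \<open>
  Functors to vector spaces from a category whose objects are the natural numbers, with
  morphisms \<open>m \<rightarrow> n\<close> the set \<open>Hom m n\<close> encoded as above.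
\<close>

locale hom_module = vector_space scale
  for Hom :: "nat \<Rightarrow> nat \<Rightarrow> (int \<Rightarrow> int) set"
    and scale :: "'k::field \<Rightarrow> 'v::ab_group_add \<Rightarrow> 'v" +
  fixes V :: "nat \<Rightarrow> 'v set" and F :: "nat \<Rightarrow> nat \<Rightarrow> (int \<Rightarrow> int) \<Rightarrow> 'v \<Rightarrow> 'v"
  assumes space_subspace: "subspace (V n)"
    and map_linear: "\<phi> \<in> Hom m n \<Longrightarrow> linear_on scale scale (V m) (V n) (F m n \<phi>)"
    and map_id: "v \<in> V n \<Longrightarrow> F n n (id_incl n) v = v"
    and map_comp: "\<lbrakk>\<phi> \<in> Hom l m; \<psi> \<in> Hom m n; v \<in> V l\<rbrakk>
      \<Longrightarrow> F l n (\<psi> \<circ> \<phi>) v = F m n \<psi> (F l m \<phi> v)"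

abbreviation "FI_module W \<equiv> hom_module (FI_hom W)"

text \<open>
  Since \<open>FI_hom W m n \<subseteq> FI_sharp_hom W m n\<close>, the underlying \<open>FI\<^sub>W\<close>-module of an
  \<open>FI\<^sub>W#\<close>-module \<open>(V, F)\<close> is \<open>(V, F)\<close> itself.
\<close>

abbreviation "FI_sharp_module W \<equiv> hom_module (FI_sharp_hom W)"

definition generated_in_stage ::
  "weyl_type \<Rightarrow> ('k::field \<Rightarrow> 'v::ab_group_add \<Rightarrow> 'v) \<Rightarrow> (nat \<Rightarrow> 'v set)
    \<Rightarrow> (nat \<Rightarrow> nat \<Rightarrow> (int \<Rightarrow> int) \<Rightarrow> 'v \<Rightarrow> 'v) \<Rightarrow> nat \<Rightarrow> bool"
  where "generated_in_stage W scale V F d \<longleftrightarrow>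
    (\<forall>m\<ge>d. module.span scale (\<Union>\<phi>\<in>FI_hom W d m. F d m \<phi> ` V d) = V m)"

definition finitely_generated ::
  "weyl_type \<Rightarrow> ('k::field \<Rightarrow> 'v::ab_group_add \<Rightarrow> 'v) \<Rightarrow> (nat \<Rightarrow> 'v set)
    \<Rightarrow> (nat \<Rightarrow> nat \<Rightarrow> (int \<Rightarrow> int) \<Rightarrow> 'v \<Rightarrow> 'v) \<Rightarrow> bool"
  where "finitely_generated W scale V F \<longleftrightarrow>
    (\<exists>d. generated_in_stage W scale V F d \<and> (\<exists>B. finite B \<and> module.span scale B = V d))"

definition averaging_map ::
  "weyl_type \<Rightarrow> ('k::field \<Rightarrow> 'v::ab_group_add \<Rightarrow> 'v) \<Rightarrow> (nat \<Rightarrow> nat \<Rightarrow> (int \<Rightarrow> int) \<Rightarrow> 'v \<Rightarrow> 'v)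
    \<Rightarrow> nat \<Rightarrow> 'v \<Rightarrow> 'v"
  where "averaging_map W scale F n v =
    average (weyl_group W (Suc n)) scale (F (Suc n) (Suc n)) (F n (Suc n) (id_incl n) v)"


section \<open>The representations \<open>V(\<mu>)\<^sub>n\<close>\<close>

text \<open>
  A partition is the weakly decreasing list of its parts. A single partition \<open>\<mu>\<close>, as used in
  type A, is the pair \<open>(\<mu>, [])\<close>.
\<close>

definition is_partition :: "nat list \<Rightarrow> bool"
  where "is_partition \<mu> \<longleftrightarrow> sorted_wrt (\<ge>) \<mu> \<and> 0 \<notin> set \<mu>"

type_synonym label = "nat list \<times> nat list"

definition label_size :: "label \<Rightarrow> nat"
  where "label_size \<mu> = sum_list (fst \<mu>) + sum_list (snd \<mu>)"

definition first_part :: "nat list \<Rightarrow> nat"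
  where "first_part \<mu> = (case \<mu> of [] \<Rightarrow> 0 | x # _ \<Rightarrow> x)"

text \<open>The \<open>\<mu>\<close> for which \<open>V(\<mu>)\<^sub>n\<close> is defined.\<close>

definition labels :: "weyl_type \<Rightarrow> nat \<Rightarrow> label set"
  where "labels W n = {\<mu>. is_partition (fst \<mu>) \<and> is_partition (snd \<mu>) \<and> (W = TypeA \<longrightarrow> snd \<mu> = [])
    \<and> label_size \<mu> + first_part (fst \<mu>) \<le> n}"

text \<open>\<open>\<mu>[n]\<close>. The new first row may be empty, in which case it is \<open>0\<close>.\<close>

definition padded :: "nat \<Rightarrow> label \<Rightarrow> label"
  where "padded n \<mu> = ((n - label_size \<mu>) # fst \<mu>, snd \<mu>)"

text \<open>
  The tableau of shape \<open>\<mu>\<close> filled with \<open>a + 1, a + 2, \<dots>\<close> in reading order; \<open>i\<close> and \<open>j\<close>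
  count rows and columns from \<open>0\<close>.
\<close>

definition tableau_entry :: "nat \<Rightarrow> nat list \<Rightarrow> nat \<Rightarrow> nat \<Rightarrow> int"
  where "tableau_entry a \<mu> i j = int (a + sum_list (take i \<mu>) + j + 1)"

definition tableau_rows :: "nat \<Rightarrow> nat list \<Rightarrow> int set set"
  where "tableau_rows a \<mu> = {{tableau_entry a \<mu> i j | j. j < \<mu> ! i} | i. i < length \<mu>}"

definition tableau_cols :: "nat \<Rightarrow> nat list \<Rightarrow> int set set"
  where "tableau_cols a \<mu> = {{tableau_entry a \<mu> i j | i. i < length \<mu> \<and> j < \<mu> ! i} | j. True}"

text \<open>For a double partition of \<open>n\<close>, the second tableau continues the numbering of the first.\<close>

definition row_group :: "nat \<Rightarrow> label \<Rightarrow> (int \<Rightarrow> int) set"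
  where "row_group n \<mu> = {p \<in> FI_hom TypeA n n.
    \<forall>X \<in> tableau_rows 0 (fst \<mu>) \<union> tableau_rows (sum_list (fst \<mu>)) (snd \<mu>). p ` X = X}"

definition col_group :: "nat \<Rightarrow> label \<Rightarrow> (int \<Rightarrow> int) set"
  where "col_group n \<mu> = {p \<in> FI_hom TypeA n n.
    \<forall>X \<in> tableau_cols 0 (fst \<mu>) \<union> tableau_cols (sum_list (fst \<mu>)) (snd \<mu>). p ` X = X}"

definition sign_changes :: "weyl_type \<Rightarrow> nat \<Rightarrow> (int \<Rightarrow> int) set"
  where "sign_changes W n = (if W = TypeA then {id_incl n}
    else {s \<in> FI_BC_hom n n. \<forall>t\<in>signed n. \<bar>s t\<bar> = \<bar>t\<bar>})"

text \<open>
  Elements of a group algebra \<open>k[G]\<close> are functions \<open>G \<rightarrow> k\<close>, extended by zero.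
  For \<open>\<mu> = (\<mu>\<^sup>+, \<mu>\<^sup>-)\<close> a double partition of \<open>n\<close> with \<open>a = \<bar>\<mu>\<^sup>+\<bar>\<close>, the element below is
  \<open>c \<cdot> e\<close>, where \<open>c = (\<Sum>p. p) \<cdot> (\<Sum>q. sgn(q) q)\<close> is the product of the Young symmetrizers of the
  two tableaux and \<open>e = \<Prod>\<^sub>i\<^sub>\<le>\<^sub>a (1 + s\<^sub>i) \<cdot> \<Prod>\<^sub>i\<^sub>>\<^sub>a (1 - s\<^sub>i)\<close>, with \<open>s\<^sub>i\<close> changing the sign of \<open>\<plusminus>i\<close>
  (in type A, \<open>e = 1\<close>).
\<close>

definition symmetrizer :: "weyl_type \<Rightarrow> nat \<Rightarrow> label \<Rightarrow> (int \<Rightarrow> int) \<Rightarrow> 'k::field"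
  where "symmetrizer W n \<mu> h =
    (\<Sum>p\<in>row_group n \<mu>. \<Sum>q\<in>col_group n \<mu>. \<Sum>s\<in>sign_changes W n.
      if h = p \<circ> q \<circ> s
      then of_int (sign_on {1..int n} q)
        * (- 1) ^ card {t \<in> {int (sum_list (fst \<mu>)) + 1..int n}. s t < 0}
      else 0)"

definition left_mult :: "('g, 'm) monoid_scheme \<Rightarrow> 'g \<Rightarrow> ('g \<Rightarrow> 'k::field) \<Rightarrow> ('g \<Rightarrow> 'k)"
  where "left_mult G g f = (\<lambda>h. if h \<in> carrier G then f (inv\<^bsub>G\<^esub> g \<otimes>\<^bsub>G\<^esub> h) else 0)"

definition fun_scale :: "'k::field \<Rightarrow> ('g \<Rightarrow> 'k) \<Rightarrow> ('g \<Rightarrow> 'k)"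
  where "fun_scale a f = (\<lambda>h. a * f h)"

text \<open>
  \<open>V(\<mu>)\<^sub>n\<close> is the left ideal generated by the symmetrizer of \<open>\<mu>[n]\<close>, in \<open>k[S\<^sub>n]\<close> in type A and
  in \<open>k[B\<^sub>n]\<close> in the other types. In the latter, it is the representation induced
  from \<open>B\<^sub>a \<times> B\<^sub>n\<^sub>-\<^sub>a\<close> of the Specht module of \<open>\<mu>[n]\<^sup>+\<close>, on which sign changes act trivially, times
  the Specht module of \<open>\<mu>[n]\<^sup>-\<close>, on which each \<open>s\<^sub>i\<close> acts as \<open>-1\<close>. In type D, only the elements
  of \<open>D\<^sub>n\<close> are used to act.
\<close>

definition ambient_type :: "weyl_type \<Rightarrow> weyl_type"
  where "ambient_type W = (if W = TypeA then TypeA else TypeBC)"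

definition V_act :: "weyl_type \<Rightarrow> nat \<Rightarrow> (int \<Rightarrow> int) \<Rightarrow> ((int \<Rightarrow> int) \<Rightarrow> 'k::field) \<Rightarrow> ((int \<Rightarrow> int) \<Rightarrow> 'k)"
  where "V_act W n = left_mult (weyl_group (ambient_type W) n)"

definition V_rep :: "weyl_type \<Rightarrow> nat \<Rightarrow> label \<Rightarrow> ((int \<Rightarrow> int) \<Rightarrow> 'k::field) set"
  where "V_rep W n \<mu> =
    group_span (weyl_group (ambient_type W) n) fun_scale (V_act W n) {symmetrizer W n (padded n \<mu>)}"


section \<open>Uniform representation stability\<close>

text \<open>
  \<open>c \<mu> n\<close> is the multiplicity \<open>c\<^bsub>\<mu>,n\<^esub>\<close>, which is zero when \<open>V(\<mu>)\<^sub>n\<close> is not defined. It is a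
  parameter because in type D it is not determined by the module: there
  \<open>V(\<mu>)\<^sub>n \<cong> V(\<nu>)\<^sub>n\<close> if \<open>\<nu>[n]\<close> is \<open>\<mu>[n]\<close> with its two partitions exchanged.
\<close>

definition uniformly_rep_stable ::
  "weyl_type \<Rightarrow> ('k::field \<Rightarrow> 'v::ab_group_add \<Rightarrow> 'v) \<Rightarrow> (nat \<Rightarrow> 'v set)
    \<Rightarrow> (nat \<Rightarrow> nat \<Rightarrow> (int \<Rightarrow> int) \<Rightarrow> 'v \<Rightarrow> 'v) \<Rightarrow> (label \<Rightarrow> nat \<Rightarrow> nat) \<Rightarrow> nat \<Rightarrow> bool"
  where "uniformly_rep_stable W scale V F c N \<longleftrightarrow>
    (\<forall>\<^sub>F n in sequentially. inj_on (F n (Suc n) (id_incl n)) (V n)) \<and>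
    (\<forall>\<^sub>F n in sequentially.
      group_span (weyl_group W (Suc n)) scale (F (Suc n) (Suc n)) (F n (Suc n) (id_incl n) ` V n)
        = V (Suc n)) \<and>
    (\<forall>n\<ge>N. (\<forall>\<mu>. \<mu> \<notin> labels W n \<longrightarrow> c \<mu> n = 0) \<and>
      rep_isomorphic (weyl_group W n) scale (V n) (F n n)
        (direct_sum_scale fun_scale)
        (direct_sum {(\<mu>, i). i < c \<mu> n} (\<lambda>(\<mu>, i). V_rep W n \<mu>))
        (direct_sum_act (V_act W n))) \<and>
    (\<forall>\<mu>. \<forall>n\<ge>N. c \<mu> n = c \<mu> N)"

end

theory Submission
  imports Defs
begin

text \<open>
  Averaging absorbs group elements, so averaging a spanning set \<open>h \<cdot> \<phi>(v)\<close> of \<open>V\<^sub>2\<close> gives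
  averages of \<open>\<phi>(v)\<close>, and there \<open>v\<close> may be replaced by its own average; this is the
  surjectivity. In the stable range the decomposition of \<open>V\<^sub>n\<close> shows that the dimension of the
  invariants is the multiplicity of the trivial representation, which does not depend on \<open>n\<close>.

  For an \<open>FI\<^sub>W#\<close>-module no dimension count is needed. Let \<open>P\<close> be the map induced by the
  projection that forgets \<open>\<plusminus>(n + 1)\<close>. On invariants, \<open>P \<circ> average\<close> at level \<open>n\<close> is a positive
  multiple of the identity plus a nonnegative multiple of \<open>average \<circ> P\<close> at level \<open>n - 1\<close>. As
  \<open>A B\<close> and \<open>B A\<close> have the same nonzero eigenvalues, all eigenvalues of \<open>P \<circ> average\<close> are
  positive by induction on \<open>n\<close>, and the averaging map is injective.
\<close>

section \<open>Signed injections\<close>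

text \<open>Condition (III) of stability constrains isomorphism types only, not the maps
  \<open>V(i_n)\<close>. Injectivity in the stable range therefore comes from surjectivity between
  spaces of equal finite dimension, whence both \<open>n \<ge> N\<close> and
  \<open>n \<ge> d\<close>. Type D adds an obstacle: the representation of \<open>([], [n])\<close>
  at level \<open>n\<close> is the parity character of \<open>B_n\<close>, which is trivial on
  \<open>D_n\<close>. For \<open>n > N\<close> stability excludes it, since \<open>([], [n])\<close>
  is too large to be a label at \<open>N\<close>. At \<open>n = N\<close> it can occur, and its
  invariant disappears at \<open>N + 1\<close>; so its multiplicity there is assumed to vanish.

  The invariants of \<open>V(\<mu>)\<close> are found inside the group algebra. Invariants of a left
  ideal \<open>k[G] x\<close> are constant functions (in type D a second coset has to be dealt
  with), and nonzero constants lie in the ideal exactly if the coefficients of \<open>x\<close> have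
  nonzero sum. For a symmetrizer this sum factors, and sign-reversing involutions kill a factor
  unless the label is trivial.

  A field of characteristic zero need not be ordered. Positivity of eigenvalues of \<open>T\<close>
  is replaced by: \<open>x T v + y v = 0\<close> with natural numbers \<open>x > 0\<close> and
  \<open>y\<close> forces \<open>v = 0\<close>.\<close>

lemma signed_iff: "t \<in> signed n \<longleftrightarrow> t \<noteq> 0 \<and> \<bar>t\<bar> \<le> int n"
  by (simp add: signed_def)

lemma zero_notin_signed [simp]: "0 \<notin> signed n"
  by (simp add: signed_def)

lemma signed_eq: "signed n = {- int n..int n} - {0}"
  by (auto simp: signed_def)

lemma finite_signed [simp]: "finite (signed n)"
  by (simp add: signed_eq)

lemma card_signed: "card (signed n) = 2 * n"
  by (simp add: signed_eq)

lemma FI_BC_homI: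
  assumes "\<And>t. t \<notin> signed m \<Longrightarrow> \<phi> t = 0" "\<And>t. t \<in> signed m \<Longrightarrow> \<phi> t \<in> signed n"
    "\<And>t. t \<in> signed m \<Longrightarrow> \<phi> (- t) = - \<phi> t"
    "\<And>s t. s \<in> signed m \<Longrightarrow> t \<in> signed m \<Longrightarrow> \<phi> s = \<phi> t \<Longrightarrow> s = t"
  shows "\<phi> \<in> FI_BC_hom m n"
  using assms by (auto simp: FI_BC_hom_def inj_on_def)

lemma
  assumes "\<phi> \<in> FI_BC_hom m n"
  shows FI_BC_hom_outside: "t \<notin> signed m \<Longrightarrow> \<phi> t = 0"
    and FI_BC_hom_signed: "t \<in> signed m \<Longrightarrow> \<phi> t \<in> signed n"
    and FI_BC_hom_inj: "inj_on \<phi> (signed m)"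
    and FI_BC_hom_uminus: "\<phi> (- t) = - \<phi> t"
    and FI_BC_hom_eq_0_iff: "\<phi> t = 0 \<longleftrightarrow> t \<notin> signed m"
proof -
  have z: "\<phi> t = 0" if "t \<notin> signed m" for t
    using assms that by (auto simp: FI_BC_hom_def)
  moreover have s: "\<phi> t \<in> signed n" if "t \<in> signed m" for t
    using assms that by (auto simp: FI_BC_hom_def)
  ultimately show "t \<notin> signed m \<Longrightarrow> \<phi> t = 0" "t \<in> signed m \<Longrightarrow> \<phi> t \<in> signed n"
    and "\<phi> t = 0 \<longleftrightarrow> t \<notin> signed m"
    by (auto simp: signed_iff)
  show "inj_on \<phi> (signed m)"
    using assms by (auto simp: FI_BC_hom_def)
  show "\<phi> (- t) = - \<phi> t"
    using assms z[of t] z[of "- t"] by (cases "t \<in> signed m") (auto simp: FI_BC_hom_def signed_iff)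
qed

lemma FI_BC_hom_abs:
  assumes "\<phi> \<in> FI_BC_hom m n"
  shows "\<bar>\<phi> t\<bar> = \<bar>\<phi> \<bar>t\<bar>\<bar>"
  using FI_BC_hom_uminus[OF assms, of t] by (auto simp: abs_if)

lemma FI_BC_hom_abs_eq_iff:
  assumes "\<phi> \<in> FI_BC_hom m n" "s \<in> signed m" "t \<in> signed m"
  shows "\<bar>\<phi> s\<bar> = \<bar>\<phi> t\<bar> \<longleftrightarrow> \<bar>s\<bar> = \<bar>t\<bar>"
proof
  assume "\<bar>\<phi> s\<bar> = \<bar>\<phi> t\<bar>"
  then have "\<phi> s = \<phi> t \<or> \<phi> s = \<phi> (- t)"
    by (auto simp: abs_eq_iff FI_BC_hom_uminus[OF assms(1)])
  moreover have "- t \<in> signed m"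
    using assms by (simp add: signed_iff)
  ultimately have "s = t \<or> s = - t"
    using FI_BC_hom_inj[OF assms(1)] assms(2,3) by (auto dest: inj_onD)
  then show "\<bar>s\<bar> = \<bar>t\<bar>" by auto
next
  assume "\<bar>s\<bar> = \<bar>t\<bar>"
  then show "\<bar>\<phi> s\<bar> = \<bar>\<phi> t\<bar>"
    by (metis FI_BC_hom_abs[OF assms(1)])
qed

lemma FI_BC_hom_comp:
  assumes \<phi>: "\<phi> \<in> FI_BC_hom l m" and \<psi>: "\<psi> \<in> FI_BC_hom m n"
  shows "\<psi> \<circ> \<phi> \<in> FI_BC_hom l n"
proof (rule FI_BC_homI)
  fix s t assume "s \<in> signed l" "t \<in> signed l" "(\<psi> \<circ> \<phi>) s = (\<psi> \<circ> \<phi>) t"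
  then show "s = t"
    using assms by (metis FI_BC_hom_inj FI_BC_hom_signed comp_apply inj_onD)
next
  fix t assume "t \<notin> signed l"
  then show "(\<psi> \<circ> \<phi>) t = 0"
    using FI_BC_hom_outside[OF \<phi>] FI_BC_hom_outside[OF \<psi>, of 0] by simp
next
  fix t assume "t \<in> signed l"
  then show "(\<psi> \<circ> \<phi>) t \<in> signed n"
    using FI_BC_hom_signed[OF \<phi>] FI_BC_hom_signed[OF \<psi>] by simp
next
  fix t show "(\<psi> \<circ> \<phi>) (- t) = - (\<psi> \<circ> \<phi>) t"
    by (simp add: FI_BC_hom_uminus[OF \<phi>] FI_BC_hom_uminus[OF \<psi>])
qed

lemma id_incl_BC: "m \<le> n \<Longrightarrow> id_incl m \<in> FI_BC_hom m n"
  by (rule FI_BC_homI) (auto simp: id_incl_def signed_iff)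

lemma FI_BC_hom_bij_betw_iff:
  assumes "\<phi> \<in> FI_BC_hom m n"
  shows "bij_betw \<phi> (signed m) (signed n) \<longleftrightarrow> m = n"
proof
  assume "bij_betw \<phi> (signed m) (signed n)"
  then show "m = n"
    using bij_betw_same_card card_signed by fastforce
next
  assume "m = n"
  moreover have "\<phi> ` signed m \<subseteq> signed n"
    using FI_BC_hom_signed[OF assms] by blast
  ultimately show "bij_betw \<phi> (signed m) (signed n)"
    using FI_BC_hom_inj[OF assms] by (auto simp: bij_betw_def endo_inj_surj)
qed

section \<open>The parity of the number of sign reversals\<close>

definition sgn_prod :: "nat \<Rightarrow> (int \<Rightarrow> int) \<Rightarrow> int"
  where "sgn_prod n g = (\<Prod>t\<in>{1..int n}. sgn (g t))"

lemma prod_sgn_eq: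
  fixes f :: "int \<Rightarrow> int"
  assumes "finite T" "\<And>t. t \<in> T \<Longrightarrow> f t \<noteq> 0"
  shows "(\<Prod>t\<in>T. sgn (f t)) = (- 1) ^ card {t \<in> T. f t < 0}"
proof -
  have "(\<Prod>t\<in>T. sgn (f t)) = (\<Prod>t\<in>T. if f t < 0 then - 1 else 1)"
    using assms(2) by (intro prod.cong) (auto simp: sgn_if)
  also have "\<dots> = (- 1) ^ card {t \<in> T. f t < 0}"
    using assms(1) by (simp add: prod.If_cases Int_def)
  finally show ?thesis .
qed

lemma FI_hom_TypeA: "\<phi> \<in> FI_hom TypeA m n \<longleftrightarrow>
    \<phi> \<in> FI_BC_hom m n \<and> (\<forall>t\<in>signed m. sgn (\<phi> t) = sgn t)"
  by (simp add: FI_hom_def)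

lemma FI_hom_TypeBC: "\<phi> \<in> FI_hom TypeBC m n \<longleftrightarrow> \<phi> \<in> FI_BC_hom m n"
  by (simp add: FI_hom_def)

lemma FI_hom_TypeD: "\<phi> \<in> FI_hom TypeD m n \<longleftrightarrow>
    \<phi> \<in> FI_BC_hom m n \<and> (m = n \<longrightarrow> sgn_prod m \<phi> = 1)"
proof (cases "\<phi> \<in> FI_BC_hom m n")
  case True
  have "sgn_prod m \<phi> = (- 1) ^ card {t \<in> {1..int m}. \<phi> t < 0}"
    unfolding sgn_prod_def
    by (rule prod_sgn_eq) (auto simp: FI_BC_hom_eq_0_iff[OF True] signed_iff)
  then have "sgn_prod m \<phi> = 1 \<longleftrightarrow> even (card {t \<in> {1..int m}. \<phi> t < 0})"
    by (simp add: minus_one_power_iff)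
  then show ?thesis
    using True FI_BC_hom_bij_betw_iff[OF True] by (auto simp: FI_hom_def)
qed (simp add: FI_hom_def)

lemmas FI_hom_iff = FI_hom_TypeA FI_hom_TypeBC FI_hom_TypeD

lemma FI_hom_imp_BC: "\<phi> \<in> FI_hom W m n \<Longrightarrow> \<phi> \<in> FI_BC_hom m n"
  by (cases W) (auto simp: FI_hom_iff)

lemma FI_BC_hom_le:
  assumes "\<phi> \<in> FI_BC_hom m n"
  shows "m \<le> n"
proof -
  have "\<phi> ` signed m \<subseteq> signed n"
    using FI_BC_hom_signed[OF assms] by blast
  then show ?thesis
    using card_inj_on_le[of \<phi> "signed m" "signed n"] FI_BC_hom_inj[OF assms]
    by (simp add: card_signed)
qed

lemma bij_betw_abs:
  assumes "\<phi> \<in> FI_BC_hom n n"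
  shows "bij_betw (\<lambda>t. \<bar>\<phi> t\<bar>) {1..int n} {1..int n}"
proof -
  have "\<bar>\<phi> t\<bar> \<in> {1..int n}" if "t \<in> {1..int n}" for t
    using FI_BC_hom_signed[OF assms, of t] that by (auto simp: signed_iff)
  then have "(\<lambda>t. \<bar>\<phi> t\<bar>) ` {1..int n} \<subseteq> {1..int n}"
    by blast
  moreover have "inj_on (\<lambda>t. \<bar>\<phi> t\<bar>) {1..int n}"
  proof (rule inj_onI)
    fix s t assume "s \<in> {1..int n}" "t \<in> {1..int n}" "\<bar>\<phi> s\<bar> = \<bar>\<phi> t\<bar>"
    then show "s = t"
      using FI_BC_hom_abs_eq_iff[OF assms, of s t] by (simp add: signed_iff)
  qed
  ultimately show ?thesis
    by (simp add: bij_betw_def endo_inj_surj)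
qed

lemma sgn_FI_BC_hom:
  assumes "\<phi> \<in> FI_BC_hom m n"
  shows "sgn (\<phi> t) = sgn t * sgn (\<phi> \<bar>t\<bar>)"
proof (cases "t \<ge> 0")
  case True
  then show ?thesis
    using FI_BC_hom_outside[OF assms, of 0] by (cases "t = 0") (auto simp: signed_iff)
next
  case False
  then show ?thesis
    using FI_BC_hom_uminus[OF assms, of t] by (simp add: sgn_minus)
qed

text \<open>Makes \<open>sgn_prod\<close> a linear character of \<open>B_n\<close>; its kernel is
  \<open>D_n\<close>. The sign of \<open>g (h t)\<close> is the sign of \<open>h t\<close> times
  that of \<open>g\<close> at \<open>\<bar>h t\<bar>\<close>, and
  \<open>t \<mapsto> \<bar>h t\<bar>\<close> permutes \<open>{1..n}\<close>, so the second factors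
  multiply to \<open>sgn_prod n g\<close>.\<close>

lemma sgn_prod_comp:
  assumes "g \<in> FI_BC_hom n n" "h \<in> FI_BC_hom n n"
  shows "sgn_prod n (g \<circ> h) = sgn_prod n g * sgn_prod n h"
proof -
  have "sgn_prod n (g \<circ> h) = (\<Prod>t\<in>{1..int n}. sgn (h t)) * (\<Prod>t\<in>{1..int n}. sgn (g \<bar>h t\<bar>))"
    unfolding sgn_prod_def prod.distrib[symmetric] comp_def
    by (intro prod.cong refl sgn_FI_BC_hom[OF assms(1)])
  also have "(\<Prod>t\<in>{1..int n}. sgn (g \<bar>h t\<bar>)) = (\<Prod>t\<in>{1..int n}. sgn (g t))"
    by (rule prod.reindex_bij_betw[OF bij_betw_abs[OF assms(2)]])
  finally show ?thesis
    by (simp add: sgn_prod_def mult.commute)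
qed

lemma sgn_prod_pm1:
  assumes "g \<in> FI_BC_hom m n"
  shows "sgn_prod m g = 1 \<or> sgn_prod m g = - 1"
proof -
  have "sgn_prod m g = (- 1) ^ card {t \<in> {1..int m}. g t < 0}"
    unfolding sgn_prod_def
    by (rule prod_sgn_eq) (auto simp: FI_BC_hom_eq_0_iff[OF assms] signed_iff)
  then show ?thesis by (auto simp: minus_one_power_iff)
qed

lemma sgn_prod_id_incl [simp]: "sgn_prod n (id_incl n) = 1"
  by (auto simp: sgn_prod_def id_incl_def signed_iff intro!: prod.neutral)

lemma sgn_prod_TypeA: "g \<in> FI_hom TypeA n n \<Longrightarrow> sgn_prod n g = 1"
  by (auto simp: sgn_prod_def FI_hom_iff signed_iff intro!: prod.neutral)

lemma id_incl_FI_hom: "m \<le> n \<Longrightarrow> id_incl m \<in> FI_hom W m n"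
  by (cases W) (auto simp: FI_hom_iff id_incl_BC id_incl_def)

lemma FI_hom_comp:
  assumes "\<phi> \<in> FI_hom W l m" "\<psi> \<in> FI_hom W m n"
  shows "\<psi> \<circ> \<phi> \<in> FI_hom W l n"
proof -
  have 1: "\<phi> \<in> FI_BC_hom l m" "\<psi> \<in> FI_BC_hom m n"
    using assms FI_hom_imp_BC by blast+
  note 2 = FI_BC_hom_comp[OF 1]
  show ?thesis
  proof (cases W)
    case TypeA
    then show ?thesis
      using assms 2 FI_BC_hom_signed[OF 1(1)] by (simp add: FI_hom_iff)
  next
    case TypeBC
    then show ?thesis
      using 2 by (simp add: FI_hom_iff)
  next
    case TypeD
    have "sgn_prod l (\<psi> \<circ> \<phi>) = 1" if "l = n"
    proof -
      have "l = m" "m = n"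
        using that FI_BC_hom_le[OF 1(1)] FI_BC_hom_le[OF 1(2)] by auto
      then show ?thesis
        using assms 1 TypeD by (simp add: FI_hom_iff sgn_prod_comp)
    qed
    then show ?thesis
      using 2 TypeD by (simp add: FI_hom_iff)
  qed
qed

lemma FI_BC_hom_comp_id_incl:
  assumes "\<phi> \<in> FI_BC_hom m n"
  shows "\<phi> \<circ> id_incl m = \<phi>"
  using FI_BC_hom_outside[OF assms] by (simp add: fun_eq_iff id_incl_def)

lemma id_incl_comp_FI_BC_hom:
  assumes "\<phi> \<in> FI_BC_hom m n"
  shows "id_incl n \<circ> \<phi> = \<phi>"
  using FI_BC_hom_outside[OF assms] FI_BC_hom_signed[OF assms]
  by (fastforce simp: fun_eq_iff id_incl_def)

lemma id_incl_comp_id_incl: "m \<le> n \<Longrightarrow> id_incl n \<circ> id_incl m = id_incl m"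
  by (rule id_incl_comp_FI_BC_hom[OF id_incl_BC])

section \<open>The Weyl groups as finite groups\<close>

lemma FI_hom_inverse:
  assumes g: "g \<in> FI_hom W n n"
  shows "\<exists>h\<in>FI_hom W n n. h \<circ> g = id_incl n"
proof -
  have BC: "g \<in> FI_BC_hom n n"
    using g FI_hom_imp_BC by blast
  have bij: "bij_betw g (signed n) (signed n)"
    using FI_BC_hom_bij_betw_iff[OF BC] by simp
  let ?i = "inv_into (signed n) g"
  define h where "h = (\<lambda>t. if t \<in> signed n then ?i t else 0)"
  have i: "?i t \<in> signed n" "g (?i t) = t" if "t \<in> signed n" for t
    using bij that by (auto simp: bij_betw_def f_inv_into_f inv_into_into)
  have gi: "?i (g t) = t" if "t \<in> signed n" for t
    using bij that by (simp add: bij_betw_def)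
  have m: "?i (- t) = - ?i t" if "t \<in> signed n" for t
    using gi[of "- ?i t"] i[OF that] by (simp add: FI_BC_hom_uminus[OF BC] signed_iff)
  have h: "h \<in> FI_BC_hom n n"
  proof (rule FI_BC_homI)
    fix s t assume "s \<in> signed n" "t \<in> signed n" "h s = h t"
    then show "s = t" using i by (metis h_def)
  next
    fix t assume t: "t \<in> signed n"
    then have "- t \<in> signed n" by (simp add: signed_iff)
    with t show "h (- t) = - h t" using m by (simp add: h_def)
  qed (auto simp: h_def i)
  have hg: "h \<circ> g = id_incl n"
    using FI_BC_hom_signed[OF BC] FI_BC_hom_outside[OF BC]
    by (auto simp: h_def fun_eq_iff id_incl_def gi signed_iff)
  have "h \<in> FI_hom W n n"
  proof (cases W)
    case TypeA
    then have "sgn (g t) = sgn t" if "t \<in> signed n" for t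
      using g that by (simp add: FI_hom_iff)
    then have "sgn (h t) = sgn t" if "t \<in> signed n" for t
      using i[OF that] that by (metis h_def)
    then show ?thesis using h TypeA by (simp add: FI_hom_iff)
  next
    case TypeD
    then have "sgn_prod n g = 1" using g by (simp add: FI_hom_iff)
    then have "sgn_prod n h = 1"
      using sgn_prod_comp[OF h BC] by (simp add: hg)
    then show ?thesis using h TypeD by (simp add: FI_hom_iff)
  qed (use h in \<open>simp add: FI_hom_iff\<close>)
  with hg show ?thesis by blast
qed

lemma carrier_weyl_group [simp]: "carrier (weyl_group W n) = FI_hom W n n"
  and mult_weyl_group [simp]: "g \<otimes>\<^bsub>weyl_group W n\<^esub> h = g \<circ> h"
  and one_weyl_group [simp]: "\<one>\<^bsub>weyl_group W n\<^esub> = id_incl n"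
  by (simp_all add: weyl_group_def)

lemma group_weyl_group: "group (weyl_group W n)"
  by (rule groupI)
     (auto simp: id_incl_FI_hom FI_hom_comp comp_assoc FI_hom_inverse
       id_incl_comp_FI_BC_hom[OF FI_hom_imp_BC])

lemma finite_FI_hom [simp]: "finite (FI_hom W m n)"
proof (rule finite_subset)
  show "FI_hom W m n \<subseteq> {f. \<forall>t. (t \<in> signed m \<longrightarrow> f t \<in> signed n) \<and> (t \<notin> signed m \<longrightarrow> f t = 0)}"
    using FI_BC_hom_signed FI_BC_hom_outside FI_hom_imp_BC by blast
  show "finite {f. \<forall>t. (t \<in> signed m \<longrightarrow> f t \<in> signed n) \<and> (t \<notin> signed m \<longrightarrow> f t = (0::int))}"
    by (rule finite_set_of_finite_funs) auto
qed

text \<open>Wreath product coordinates: \<open>\<pi>\<close> holds the absolute values and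
  \<open>\<epsilon>\<close> the signs of the images of positive elements; the factor
  \<open>sgn t\<close> extends the map to an odd function.\<close>

definition signed_perm :: "nat \<Rightarrow> (int \<Rightarrow> int) \<Rightarrow> (int \<Rightarrow> int) \<Rightarrow> int \<Rightarrow> int"
  where "signed_perm n \<epsilon> \<pi> t = (if t \<in> signed n then sgn t * \<epsilon> \<bar>t\<bar> * \<pi> \<bar>t\<bar> else 0)"

lemma
  assumes \<pi>: "inj_on \<pi> {1..int m}" "\<pi> ` {1..int m} \<subseteq> {1..int n}"
    and \<epsilon>: "\<And>t. t \<in> {1..int m} \<Longrightarrow> \<epsilon> t \<in> {1, - 1}"
  shows signed_perm_BC: "signed_perm m \<epsilon> \<pi> \<in> FI_BC_hom m n"
    and sgn_prod_signed_perm: "sgn_prod m (signed_perm m \<epsilon> \<pi>) = prod \<epsilon> {1..int m}"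
    and sgn_signed_perm: "t \<in> signed m \<Longrightarrow> sgn (signed_perm m \<epsilon> \<pi> t) = sgn t * \<epsilon> \<bar>t\<bar>"
proof -
  have \<pi>': "\<pi> \<bar>t\<bar> \<ge> 1" "\<pi> \<bar>t\<bar> \<le> int n" if "t \<in> signed m" for t
  proof -
    have "\<bar>t\<bar> \<in> {1..int m}" using that by (auto simp: signed_iff)
    then have "\<pi> \<bar>t\<bar> \<in> {1..int n}" using \<pi>(2) by blast
    then show "\<pi> \<bar>t\<bar> \<ge> 1" "\<pi> \<bar>t\<bar> \<le> int n" by auto
  qed
  have \<epsilon>': "\<epsilon> \<bar>t\<bar> = 1 \<or> \<epsilon> \<bar>t\<bar> = - 1" if "t \<in> signed m" for t
    using \<epsilon>[of "\<bar>t\<bar>"] that by (auto simp: signed_iff)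
  have abs: "\<bar>signed_perm m \<epsilon> \<pi> t\<bar> = \<pi> \<bar>t\<bar>" if "t \<in> signed m" for t
    using \<pi>'[OF that] \<epsilon>'[OF that] that by (auto simp: signed_perm_def signed_iff abs_mult)
  have sgn: "sgn (signed_perm m \<epsilon> \<pi> t) = sgn t * \<epsilon> \<bar>t\<bar>" if "t \<in> signed m" for t
    using \<pi>'[OF that] \<epsilon>'[OF that] that by (auto simp: signed_perm_def signed_iff sgn_mult)
  then show "t \<in> signed m \<Longrightarrow> sgn (signed_perm m \<epsilon> \<pi> t) = sgn t * \<epsilon> \<bar>t\<bar>" .
  show "signed_perm m \<epsilon> \<pi> \<in> FI_BC_hom m n"
  proof (rule FI_BC_homI)
    fix t assume t: "t \<in> signed m"
    show "signed_perm m \<epsilon> \<pi> t \<in> signed n"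
      unfolding signed_iff using abs[OF t] \<pi>'[OF t] by linarith
    show "signed_perm m \<epsilon> \<pi> (- t) = - signed_perm m \<epsilon> \<pi> t"
      using t by (simp add: signed_perm_def signed_iff)
  next
    fix s t assume st: "s \<in> signed m" "t \<in> signed m" and eq: "signed_perm m \<epsilon> \<pi> s = signed_perm m \<epsilon> \<pi> t"
    have "\<pi> \<bar>s\<bar> = \<pi> \<bar>t\<bar>"
      using abs[OF st(1)] abs[OF st(2)] eq by simp
    then have st': "\<bar>s\<bar> = \<bar>t\<bar>"
      using st by (auto intro: inj_onD[OF \<pi>(1)] simp: signed_iff)
    have "sgn s * \<epsilon> \<bar>s\<bar> = sgn t * \<epsilon> \<bar>s\<bar>"
      using sgn[OF st(1)] sgn[OF st(2)] eq st' by metis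
    moreover have "\<epsilon> \<bar>s\<bar> \<noteq> 0"
      using \<epsilon>'[OF st(1)] by auto
    ultimately have "sgn s = sgn t"
      by simp
    with st' show "s = t"
      by (metis abs_mult_sgn mult.commute)
  qed (simp add: signed_perm_def)
  show "sgn_prod m (signed_perm m \<epsilon> \<pi>) = prod \<epsilon> {1..int m}"
    unfolding sgn_prod_def by (rule prod.cong) (auto simp: sgn signed_iff)
qed

text \<open>The complements of \<open>A\<close> and of its image have equal finite cardinality, and
  any bijection between them completes \<open>f\<close>.\<close>

lemma inj_on_extend_permutation:
  assumes "finite B" "A \<subseteq> B" "inj_on f A" "f ` A \<subseteq> B"
  shows "\<exists>\<pi>. bij_betw \<pi> B B \<and> (\<forall>a\<in>A. \<pi> a = f a)"
proof -
  have "card (B - A) = card (B - f ` A)"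
    using assms by (simp add: card_Diff_subset finite_subset card_image)
  then obtain g where g: "bij_betw g (B - A) (B - f ` A)"
    using assms by (metis finite_Diff finite_same_card_bij)
  let ?\<pi> = "\<lambda>a. if a \<in> A then f a else g a"
  have "bij_betw ?\<pi> (A \<union> (B - A)) (f ` A \<union> (B - f ` A))"
  proof (rule bij_betw_combine)
    show "bij_betw ?\<pi> A (f ` A)"
      using assms(3) by (auto simp: bij_betw_def inj_on_def)
    show "bij_betw ?\<pi> (B - A) (B - f ` A)"
      using g by (subst bij_betw_cong[where g = g]) auto
  qed auto
  moreover have "A \<union> (B - A) = B" "f ` A \<union> (B - f ` A) = B"
    using assms by auto
  ultimately show ?thesis by (intro exI[of _ ?\<pi>]) auto
qed

text \<open>
  In type D, the parity of the extension is corrected by the sign at \<open>m\<close>, which is not in the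
  domain of \<open>\<phi>\<close> unless \<open>d = m\<close>.
\<close>

lemma FI_hom_extend:
  assumes \<phi>: "\<phi> \<in> FI_hom W d m"
  shows "\<exists>g\<in>FI_hom W m m. g \<circ> id_incl d = \<phi>"
proof (cases "d = m")
  case True
  then show ?thesis
    using \<phi> FI_BC_hom_comp_id_incl FI_hom_imp_BC by blast
next
  case False
  have BC: "\<phi> \<in> FI_BC_hom d m" using \<phi> FI_hom_imp_BC by blast
  have dm: "d < m" using FI_BC_hom_le[OF BC] False by simp
  have "inj_on (\<lambda>t. \<bar>\<phi> t\<bar>) {1..int d}"
    using FI_BC_hom_abs_eq_iff[OF BC] by (auto simp: inj_on_def signed_iff)
  moreover have "\<bar>\<phi> t\<bar> \<in> {1..int m}" if "t \<in> {1..int d}" for t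
    using FI_BC_hom_signed[OF BC, of t] that by (auto simp: signed_iff)
  then have "(\<lambda>t. \<bar>\<phi> t\<bar>) ` {1..int d} \<subseteq> {1..int m}" by blast
  moreover have "finite {1..int m}" "{1..int d} \<subseteq> {1..int m}" using dm by auto
  ultimately obtain \<pi> where \<pi>: "bij_betw \<pi> {1..int m} {1..int m}"
    and \<pi>': "\<And>t. t \<in> {1..int d} \<Longrightarrow> \<pi> t = \<bar>\<phi> t\<bar>"
    using inj_on_extend_permutation[of "{1..int m}" "{1..int d}" "\<lambda>t. \<bar>\<phi> t\<bar>"] by blast
  define \<epsilon> :: "int \<Rightarrow> int" where "\<epsilon> t = (if t \<le> int d then sgn (\<phi> t)
    else if t = int m \<and> W = TypeD then sgn_prod d \<phi> else 1)" for t
  define g where "g = signed_perm m \<epsilon> \<pi>"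
  have pm: "sgn_prod d \<phi> = 1 \<or> sgn_prod d \<phi> = - 1"
    using BC by (rule sgn_prod_pm1)
  have \<epsilon>1: "\<epsilon> t \<in> {1, - 1}" if "t \<in> {1..int m}" for t
  proof (cases "t \<le> int d")
    case True
    then have "\<phi> t \<noteq> 0" using that by (auto simp: FI_BC_hom_eq_0_iff[OF BC] signed_iff)
    with True show ?thesis by (auto simp: \<epsilon>_def sgn_if)
  qed (use pm in \<open>auto simp: \<epsilon>_def\<close>)
  have \<pi>2: "inj_on \<pi> {1..int m}" "\<pi> ` {1..int m} \<subseteq> {1..int m}"
    using \<pi> by (auto simp: bij_betw_def)
  have g: "g \<in> FI_BC_hom m m"
    unfolding g_def by (rule signed_perm_BC[OF \<pi>2]) (rule \<epsilon>1)
  have g_sgn: "sgn (g t) = sgn t * \<epsilon> \<bar>t\<bar>" if "t \<in> signed m" for t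
    unfolding g_def by (rule sgn_signed_perm[OF \<pi>2 _ that]) (rule \<epsilon>1)
  have g_prod: "sgn_prod m g = prod \<epsilon> {1..int m}"
    unfolding g_def by (rule sgn_prod_signed_perm[OF \<pi>2]) (rule \<epsilon>1)
  have "g t = \<phi> t" if "t \<in> signed d" for t
  proof -
    have t: "\<bar>t\<bar> \<in> {1..int d}" "t \<in> signed m" using that dm by (auto simp: signed_iff)
    have "g t = sgn t * sgn (\<phi> \<bar>t\<bar>) * \<bar>\<phi> \<bar>t\<bar>\<bar>"
      using t by (simp add: g_def signed_perm_def \<epsilon>_def \<pi>')
    also have "\<dots> = sgn t * \<phi> \<bar>t\<bar>" by (simp add: mult.assoc sgn_mult_abs)
    also have "\<dots> = \<phi> t"
      using that FI_BC_hom_uminus[OF BC, of t] by (auto simp: abs_if signed_iff)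
    finally show ?thesis .
  qed
  then have "g \<circ> id_incl d = \<phi>"
    using FI_BC_hom_outside[OF BC] FI_BC_hom_outside[OF g, of 0]
    by (auto simp: fun_eq_iff id_incl_def)
  moreover have "g \<in> FI_hom W m m"
  proof (cases W)
    case TypeA
    have "\<epsilon> t = 1" if "t \<in> {1..int m}" for t
    proof (cases "t \<le> int d")
      case True
      then have "t \<in> signed d" using that by (simp add: signed_iff)
      then have "sgn (\<phi> t) = sgn t" using \<phi> TypeA by (simp add: FI_hom_iff)
      then show ?thesis using that True by (simp add: \<epsilon>_def)
    qed (simp add: \<epsilon>_def TypeA)
    then have "sgn (g t) = sgn t" if "t \<in> signed m" for t
      using g_sgn[OF that] that by (auto simp: signed_iff)
    then show ?thesis using g TypeA by (simp add: FI_hom_iff)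
  next
    case TypeD
    \<comment> \<open>The parity of \<open>\<phi>\<close> enters twice, through the signs on
      \<open>{1..d}\<close> and through the sign chosen at \<open>m\<close>, and its square is
      1.\<close>
    have "prod \<epsilon> {1..int m} = prod \<epsilon> ({1..int d} \<union> ({int d<..<int m} \<union> {int m}))"
      using dm by (intro prod.cong) auto
    also have "\<dots> = prod \<epsilon> {1..int d} * (prod \<epsilon> {int d<..<int m} * \<epsilon> (int m))"
      using dm by (simp add: prod.union_disjoint disjoint_iff)
    also have "prod \<epsilon> {int d<..<int m} = 1"
      by (rule prod.neutral) (auto simp: \<epsilon>_def)
    also have "prod \<epsilon> {1..int d} = sgn_prod d \<phi>"
      unfolding sgn_prod_def by (rule prod.cong) (auto simp: \<epsilon>_def)
    also have "\<epsilon> (int m) = sgn_prod d \<phi>"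
      using dm TypeD by (simp add: \<epsilon>_def)
    finally have "prod \<epsilon> {1..int m} = 1" using pm by auto
    then show ?thesis using g g_prod TypeD by (simp add: FI_hom_iff)
  qed (use g in \<open>simp add: FI_hom_iff\<close>)
  ultimately show ?thesis by blast
qed

section \<open>Averaging in representations of finite groups\<close>

lemma linear_onD:
  assumes "linear_on s1 s2 U W f"
  shows "x \<in> U \<Longrightarrow> f x \<in> W" "x \<in> U \<Longrightarrow> y \<in> U \<Longrightarrow> f (x + y) = f x + f y"
    "x \<in> U \<Longrightarrow> f (s1 a x) = s2 a (f x)"
  using assms by (auto simp: linear_on_def)

lemma linear_on_comp:
  assumes "linear_on s1 s2 U W f" "linear_on s2 s3 W X g"
  shows "linear_on s1 s3 U X (\<lambda>v. g (f v))"
  using assms by (auto simp: linear_on_def Pi_iff)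

lemma linear_on_sum:
  assumes "vector_space s1" "vector_space s2" "module.subspace s1 U" "linear_on s1 s2 U W f"
    and "\<And>i. i \<in> A \<Longrightarrow> x i \<in> U"
  shows "f (sum x A) = (\<Sum>i\<in>A. f (x i))"
proof -
  interpret v1: vector_space s1 by fact
  interpret v2: vector_space s2 by fact
  have f0: "f 0 = 0"
    using linear_onD(3)[OF assms(4), of 0 0] v1.subspace_0[OF assms(3)] by simp
  show ?thesis
    using assms(5)
  proof (induction A rule: infinite_finite_induct)
    case (insert a A)
    then have "sum x A \<in> U" by (intro v1.subspace_sum[OF assms(3)]) auto
    with insert show ?case using linear_onD(2)[OF assms(4)] by simp
  qed (simp_all add: f0)
qed

lemma linear_on_inj_onI:
  assumes "vector_space s1" "vector_space s2" "module.subspace s1 U" "linear_on s1 s2 U W f"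
    and "\<And>x. x \<in> U \<Longrightarrow> f x = 0 \<Longrightarrow> x = 0"
  shows "inj_on f U"
proof (rule inj_onI)
  interpret v1: vector_space s1 by fact
  interpret v2: vector_space s2 by fact
  fix x y assume xy: "x \<in> U" "y \<in> U" "f x = f y"
  have y: "s1 (- 1) y \<in> U"
    using xy by (intro v1.subspace_scale[OF assms(3)])
  have "f (x + s1 (- 1) y) = 0"
    unfolding linear_onD(2)[OF assms(4) xy(1) y] linear_onD(3)[OF assms(4) xy(2)]
    using xy(3) by simp
  then have "x + s1 (- 1) y = 0"
    using assms(5) v1.subspace_add[OF assms(3) xy(1) y] by blast
  then show "x = y" by simp
qed

context group_rep
begin

lemma act_closed: "g \<in> carrier G \<Longrightarrow> v \<in> U \<Longrightarrow> \<rho> g v \<in> U"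
  using act_linear linear_onD(1) by blast

lemma act_sum:
  "g \<in> carrier G \<Longrightarrow> (\<And>i. i \<in> A \<Longrightarrow> x i \<in> U) \<Longrightarrow> \<rho> g (sum x A) = (\<Sum>i\<in>A. \<rho> g (x i))"
  using linear_on_sum[OF vector_space_axioms vector_space_axioms carrier_subspace act_linear] .

lemma sum_act_translate:
  assumes "h \<in> carrier G" "v \<in> U"
  shows "(\<Sum>g\<in>carrier G. \<rho> g (\<rho> h v)) = (\<Sum>g\<in>carrier G. \<rho> g v)"
  using assms
  by (intro sum.reindex_bij_witness[of _ "\<lambda>g. g \<otimes> inv h" "\<lambda>g. g \<otimes> h"])
     (auto simp: m_assoc act_mult)

lemma act_sum_act:
  assumes "h \<in> carrier G" "v \<in> U"
  shows "\<rho> h (\<Sum>g\<in>carrier G. \<rho> g v) = (\<Sum>g\<in>carrier G. \<rho> g v)"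
proof -
  have "\<rho> h (\<Sum>g\<in>carrier G. \<rho> g v) = (\<Sum>g\<in>carrier G. \<rho> (h \<otimes> g) v)"
    using assms by (simp add: act_sum act_closed act_mult)
  also have "\<dots> = (\<Sum>g\<in>carrier G. \<rho> g v)"
    using assms
    by (intro sum.reindex_bij_witness[of _ "\<lambda>g. inv h \<otimes> g" "\<lambda>g. h \<otimes> g"])
       (auto simp: m_assoc[symmetric])
  finally show ?thesis .
qed

lemma sum_act_closed: "v \<in> U \<Longrightarrow> (\<Sum>g\<in>carrier G. \<rho> g v) \<in> U"
  by (intro subspace_sum[OF carrier_subspace]) (rule act_closed)

lemma sum_act_invariants: "v \<in> U \<Longrightarrow> (\<Sum>g\<in>carrier G. \<rho> g v) \<in> invariants G U \<rho>"
  by (simp add: invariants_def sum_act_closed act_sum_act)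

lemma average_closed: "v \<in> U \<Longrightarrow> average G scale \<rho> v \<in> U"
  unfolding average_def by (intro subspace_scale[OF carrier_subspace] sum_act_closed)

lemma average_linear: "linear_on scale scale U U (average G scale \<rho>)"
  using average_closed linear_onD[OF act_linear]
  by (auto simp: linear_on_def average_def sum.distrib scale_right_distrib scale_sum_right mult.commute)

lemma average_act:
  "h \<in> carrier G \<Longrightarrow> v \<in> U \<Longrightarrow> average G scale \<rho> (\<rho> h v) = average G scale \<rho> v"
  by (simp add: average_def sum_act_translate)

lemma average_invariants: "v \<in> U \<Longrightarrow> average G scale \<rho> v \<in> invariants G U \<rho>"
  using linear_onD(3)[OF act_linear] sum_act_closed
  by (auto simp: invariants_def average_closed) (simp add: average_def act_sum_act)

lemma subspace_invariants: "subspace (invariants G U \<rho>)"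
proof (rule subspaceI)
  show "0 \<in> invariants G U \<rho>"
    using act_sum[of _ "{}"] subspace_0[OF carrier_subspace] by (simp add: invariants_def)
next
  fix v w assume "v \<in> invariants G U \<rho>" "w \<in> invariants G U \<rho>"
  then show "v + w \<in> invariants G U \<rho>"
    using linear_onD(2)[OF act_linear] subspace_add[OF carrier_subspace]
    by (simp add: invariants_def)
next
  fix c v assume "v \<in> invariants G U \<rho>"
  then show "scale c v \<in> invariants G U \<rho>"
    using linear_onD(3)[OF act_linear] subspace_scale[OF carrier_subspace]
    by (simp add: invariants_def)
qed

end

lemma average_eq_self:
  fixes scale :: "'k::field_char_0 \<Rightarrow> 'v::ab_group_add \<Rightarrow> 'v"
  assumes "group_rep G scale U \<rho>" "finite (carrier G)" "v \<in> invariants G U \<rho>"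
  shows "average G scale \<rho> v = v"
proof -
  interpret group_rep G scale U \<rho> by fact
  have "card (carrier G) \<noteq> 0" using assms(2) by auto
  then show ?thesis
    using assms(3) by (simp add: average_def invariants_def sum_constant_scale)
qed

lemma averaging_linear_on:
  assumes "group_rep H2 scale2 V2 \<rho>2" "linear_on scale1 scale2 V1 V2 \<phi>"
  shows "linear_on scale1 scale2 (invariants H1 V1 \<rho>1) (invariants H2 V2 \<rho>2)
    (\<lambda>v. average H2 scale2 \<rho>2 (\<phi> v))"
proof -
  interpret group_rep H2 scale2 V2 \<rho>2 by fact
  show ?thesis
    using linear_on_comp[OF assms(2) average_linear] average_invariants linear_onD(1)[OF assms(2)]
    by (auto simp: linear_on_def invariants_def)
qed

lemma averaging_surjective:
  fixes scale1 :: "'k::field_char_0 \<Rightarrow> 'v::ab_group_add \<Rightarrow> 'v"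
    and scale2 :: "'k \<Rightarrow> 'w::ab_group_add \<Rightarrow> 'w"
  assumes 1: "group_rep H1 scale1 V1 \<rho>1" "finite (carrier H1)"
    and 2: "group_rep H2 scale2 V2 \<rho>2" "finite (carrier H2)"
    and j: "j \<in> carrier H1 \<rightarrow> carrier H2"
    and \<phi>: "linear_on scale1 scale2 V1 V2 \<phi>" "equivariant H1 j V1 \<rho>1 \<rho>2 \<phi>"
    and gen: "group_span H2 scale2 \<rho>2 (\<phi> ` V1) = V2"
  shows "(\<lambda>v. average H2 scale2 \<rho>2 (\<phi> v)) ` invariants H1 V1 \<rho>1 = invariants H2 V2 \<rho>2"
proof -
  interpret R1: group_rep H1 scale1 V1 \<rho>1 by fact
  interpret R2: group_rep H2 scale2 V2 \<rho>2 by fact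
  let ?av = "average H2 scale2 \<rho>2"
  define A where "A = (\<lambda>v. ?av (\<phi> v))"
  have A: "linear_on scale1 scale2 V1 V2 A"
    unfolding A_def by (rule linear_on_comp[OF \<phi>(1) R2.average_linear])
  \<comment> \<open>Equivariance turns \<open>g\<close> into \<open>j g\<close>, which averaging
    over \<open>H2\<close> absorbs.\<close>
  have A_act: "A (\<rho>1 g v) = A v" if "g \<in> carrier H1" "v \<in> V1" for g v
  proof -
    have "j g \<in> carrier H2" using j that(1) by blast
    then show ?thesis
      using that \<phi>(2) R2.average_act linear_onD(1)[OF \<phi>(1)]
      by (simp add: A_def equivariant_def)
  qed
  have card: "card (carrier H1) \<noteq> 0" using 1(2) by auto
  have A_average: "A (average H1 scale1 \<rho>1 v) = A v" if "v \<in> V1" for v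
  proof -
    have "A (average H1 scale1 \<rho>1 v)
        = scale2 (1 / of_nat (card (carrier H1))) (\<Sum>g\<in>carrier H1. A (\<rho>1 g v))"
      using that linear_on_sum[OF R1.vector_space_axioms R2.vector_space_axioms
          R1.carrier_subspace A, of "carrier H1" "\<lambda>g. \<rho>1 g v"]
      by (simp add: average_def linear_onD(3)[OF A R1.sum_act_closed] R1.act_closed)
    then show ?thesis
      using that card by (simp add: A_act R2.sum_constant_scale)
  qed
  \<comment> \<open>Membership in \<open>V2\<close> is carried through the induction because
    averaging is linear only on \<open>V2\<close>.\<close>
  have "w \<in> V2 \<and> (\<exists>v\<in>V1. ?av w = A v)"
    if "w \<in> R2.span (\<Union>h\<in>carrier H2. \<rho>2 h ` \<phi> ` V1)" for w
    using that
  proof (induction rule: R2.span_induct_alt)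
    case base
    have "?av 0 = A 0" "0 \<in> V1" "0 \<in> V2"
      using linear_onD(3)[OF A, of 0 0] linear_onD(3)[OF R2.average_linear, of 0 0]
        R1.subspace_0[OF R1.carrier_subspace] R2.subspace_0[OF R2.carrier_subspace]
      by simp_all
    then show ?case by blast
  next
    case (step c x y)
    then obtain h v where hv: "h \<in> carrier H2" "v \<in> V1" "x = \<rho>2 h (\<phi> v)" by blast
    then have x: "x \<in> V2" "?av x = A v"
      using linear_onD(1)[OF \<phi>(1)] by (simp_all add: A_def R2.act_closed R2.average_act)
    from step obtain u where u: "y \<in> V2" "u \<in> V1" "?av y = A u" by blast
    have cx: "scale2 c x \<in> V2" and cv: "scale1 c v \<in> V1"
      using x hv R2.subspace_scale[OF R2.carrier_subspace] R1.subspace_scale[OF R1.carrier_subspace]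
      by auto
    then have "?av (scale2 c x + y) = A (scale1 c v + u)"
      using x u hv by (simp add: linear_onD[OF A] linear_onD[OF R2.average_linear])
    moreover have "scale2 c x + y \<in> V2" "scale1 c v + u \<in> V1"
      using cx cv u R2.subspace_add[OF R2.carrier_subspace] R1.subspace_add[OF R1.carrier_subspace]
      by auto
    ultimately show ?case by blast
  qed
  then have key: "\<exists>v\<in>V1. ?av w = A v" if "w \<in> V2" for w
    using gen that by (auto simp: group_span_def)
  show ?thesis
  proof (intro equalityI subsetI)
    fix w assume w: "w \<in> invariants H2 V2 \<rho>2"
    then obtain v where v: "v \<in> V1" "?av w = A v"
      using key by (auto simp: invariants_def)
    then have "w = A (average H1 scale1 \<rho>1 v)"
      using average_eq_self[OF 2 w] A_average by simp
    then show "w \<in> (\<lambda>v. ?av (\<phi> v)) ` invariants H1 V1 \<rho>1"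
      using R1.average_invariants[OF v(1)] by (auto simp: A_def)
  next
    fix w assume "w \<in> (\<lambda>v. ?av (\<phi> v)) ` invariants H1 V1 \<rho>1"
    then show "w \<in> invariants H2 V2 \<rho>2"
      using linear_onD(1)[OF averaging_linear_on[OF 2(1) \<phi>(1)]] by blast
  qed
qed


section \<open>Dimensions of subspaces\<close>

text \<open>A finite basis is required to exist: in infinite dimension the cardinality of a basis is
  0 by convention, and a surjection between spaces of equal dimension may fail to be
  injective.\<close>

definition has_dim :: "('k::field \<Rightarrow> 'v::ab_group_add \<Rightarrow> 'v) \<Rightarrow> 'v set \<Rightarrow> nat \<Rightarrow> bool"
  where "has_dim s U c \<longleftrightarrow>
    (\<exists>B. finite B \<and> card B = c \<and> \<not> module.dependent s B \<and> module.span s B = U)"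

text \<open>Prescribing the values on a basis of \<open>U\<close> turns a map that is linear only on
  \<open>U\<close> into a linear map of the ambient space, to which results on images of spans
  apply.\<close>

lemma linear_on_extend:
  assumes "vector_space s1" "vector_space s2" "module.subspace s1 U" "linear_on s1 s2 U W f"
  shows "\<exists>g. Vector_Spaces.linear s1 s2 g \<and> (\<forall>x\<in>U. g x = f x)"
proof -
  interpret v1: vector_space s1 by fact
  interpret v2: vector_space s2 by fact
  interpret vector_space_pair s1 s2 ..
  obtain B where B: "B \<subseteq> U" "v1.independent B" "U \<subseteq> v1.span B"
    using v1.maximal_independent_subset by blast
  obtain g where g: "Vector_Spaces.linear s1 s2 g" "\<forall>x\<in>B. g x = f x"
    using linear_independent_extend[OF B(2)] by blast
  have "x \<in> U \<and> g x = f x" if "x \<in> v1.span B" for x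
    using that
  proof (induction rule: v1.span_induct_alt)
    case base
    show ?case
      using linear_onD(3)[OF assms(4), of 0 0] v1.subspace_0[OF assms(3)] linear_0[OF g(1)] by simp
  next
    case (step c x y)
    then have "x \<in> U" "s1 c x \<in> U"
      using B(1) v1.subspace_scale[OF assms(3)] by auto
    then show ?case
      using step g(2) v1.subspace_add[OF assms(3)]
      by (simp add: linear_onD[OF assms(4)] linear_add[OF g(1)] linear_scale[OF g(1)])
  qed
  with g(1) B(3) show ?thesis by blast
qed

text \<open>The image of a basis of \<open>U\<close> spans \<open>W\<close>, and every spanning set
  of \<open>W\<close> has at least \<open>c\<close> elements. So the image has exactly
  \<open>c\<close> elements, none of them redundant, and is again a basis.\<close>

lemma linear_on_surj_imp_inj:
  assumes "vector_space s1" "vector_space s2" "linear_on s1 s2 U W f" "f ` U = W"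
    and "has_dim s1 U c" "has_dim s2 W c"
  shows "inj_on f U"
proof -
  interpret v1: vector_space s1 by fact
  interpret v2: vector_space s2 by fact
  interpret vector_space_pair s1 s2 ..
  obtain B where B: "finite B" "card B = c" "v1.independent B" "v1.span B = U"
    using assms(5) by (auto simp: has_dim_def)
  obtain C where C: "finite C" "card C = c" "v2.independent C" "v2.span C = W"
    using assms(6) by (auto simp: has_dim_def)
  obtain g where g: "Vector_Spaces.linear s1 s2 g" and gf: "\<forall>x\<in>U. g x = f x"
    using linear_on_extend[OF assms(1,2) _ assms(3)] B(4) v1.subspace_span by blast
  have gB: "v2.span (g ` B) = W"
    using linear_span_image[OF g, of B] B(4) gf assms(4) by simp
  have min: "c \<le> card T" if "finite T" "v2.span T = W" for T
    using v2.independent_span_bound[OF that(1) C(3)] C(2,4) v2.span_superset that(2) by blast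
  have "card (g ` B) = card B"
    using min[OF _ gB] B(1,2) card_image_le[OF B(1), of g] by simp
  then have inj: "inj_on g B"
    using B(1) by (simp add: eq_card_imp_inj_on)
  have "v2.independent (g ` B)"
  proof
    assume "v2.dependent (g ` B)"
    then obtain x where x: "x \<in> g ` B" "x \<in> v2.span (g ` B - {x})"
      by (auto simp: v2.dependent_def)
    then have "v2.span (g ` B - {x}) = W"
      using gB v2.span_redundant[of x "g ` B - {x}"] by (simp add: insert_absorb)
    then have "c \<le> card (g ` B - {x})"
      using B(1) by (intro min) auto
    moreover have "card (g ` B - {x}) < card (g ` B)"
      using x(1) B(1) by (intro psubset_card_mono) auto
    ultimately show False
      using \<open>card (g ` B) = card B\<close> B(2) by simp
  qed
  then have "inj_on g U"
    using linear_inj_on_span_iff_independent_image[OF g] inj B(4)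
      linear_indep_image_lemma[OF g B(1) _ inj] linear_inj_on_iff_eq_0[OF g v1.subspace_span[of B]]
    by auto
  then show ?thesis
    using gf by (simp cong: inj_on_cong)
qed

lemma linear_iso_on_inverse:
  assumes "vector_space s1" "module.subspace s1 U" "linear_iso_on s1 s2 U W f"
  shows "linear_iso_on s2 s1 W U (inv_into U f)"
proof -
  interpret v1: vector_space s1 by fact
  let ?g = "inv_into U f"
  have lin: "linear_on s1 s2 U W f" and bij: "bij_betw f U W"
    using assms(3) by (auto simp: linear_iso_on_def)
  have g: "?g y \<in> U" "f (?g y) = y" if "y \<in> W" for y
    using bij that by (auto simp: bij_betw_def f_inv_into_f inv_into_into)
  have gf: "?g (f x) = x" if "x \<in> U" for x
    using bij that by (simp add: bij_betw_def)
  have "?g (x + y) = ?g x + ?g y" if "x \<in> W" "y \<in> W" for x y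
    using gf[of "?g x + ?g y"] g[OF that(1)] g[OF that(2)] v1.subspace_add[OF assms(2)]
    by (simp add: linear_onD(2)[OF lin])
  moreover have "?g (s2 a x) = s1 a (?g x)" if "x \<in> W" for a x
    using gf[of "s1 a (?g x)"] g[OF that] v1.subspace_scale[OF assms(2)]
    by (simp add: linear_onD(3)[OF lin])
  ultimately show ?thesis
    using bij_betw_inv_into[OF bij] g(1) by (auto simp: linear_iso_on_def linear_on_def)
qed

lemma has_dim_iso:
  assumes "vector_space s1" "vector_space s2" "linear_iso_on s1 s2 U W f" "has_dim s1 U c"
  shows "has_dim s2 W c"
proof -
  interpret v1: vector_space s1 by fact
  interpret v2: vector_space s2 by fact
  interpret vector_space_pair s1 s2 ..
  have lin: "linear_on s1 s2 U W f" and bij: "bij_betw f U W"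
    using assms(3) by (auto simp: linear_iso_on_def)
  obtain B where B: "finite B" "card B = c" "v1.independent B" "v1.span B = U"
    using assms(4) by (auto simp: has_dim_def)
  obtain g where g: "Vector_Spaces.linear s1 s2 g" and gf: "\<forall>x\<in>U. g x = f x"
    using linear_on_extend[OF assms(1,2) _ lin] B(4) v1.subspace_span by blast
  have inj: "inj_on g U"
    using gf bij by (simp add: bij_betw_def cong: inj_on_cong)
  have "v2.span (g ` B) = W"
    using linear_span_image[OF g, of B] B(4) gf bij by (simp add: bij_betw_def)
  moreover have "v2.independent (g ` B)"
    using linear_independent_injective_image[OF g B(3)] inj B(4) by simp
  moreover have "card (g ` B) = c"
    using B inj v1.span_superset[of B] by (metis card_image inj_on_subset)
  ultimately show ?thesis
    using B(1) by (auto simp: has_dim_def)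
qed

lemma invariants_iso:
  assumes "linear_iso_on s1 s2 U W f" "equivariant G (\<lambda>g. g) U \<rho> \<sigma> f"
    and closed: "\<And>g v. g \<in> carrier G \<Longrightarrow> v \<in> U \<Longrightarrow> \<rho> g v \<in> U"
  shows "linear_iso_on s1 s2 (invariants G U \<rho>) (invariants G W \<sigma>) f"
proof -
  have lin: "linear_on s1 s2 U W f" and bij: "bij_betw f U W"
    using assms(1) by (auto simp: linear_iso_on_def)
  have iff: "v \<in> invariants G U \<rho> \<longleftrightarrow> f v \<in> invariants G W \<sigma>" if "v \<in> U" for v
  proof -
    have "\<rho> g v = v \<longleftrightarrow> \<sigma> g (f v) = f v" if "g \<in> carrier G" for g
      using assms(2) closed[OF that \<open>v \<in> U\<close>] bij_betw_imp_inj_on[OF bij] that \<open>v \<in> U\<close>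
      by (metis equivariant_def inj_onD)
    then show ?thesis
      using that linear_onD(1)[OF lin that] by (simp add: invariants_def)
  qed
  have sub: "invariants G U \<rho> \<subseteq> U" "invariants G W \<sigma> \<subseteq> W"
    by (auto simp: invariants_def)
  have "f ` invariants G U \<rho> = invariants G W \<sigma>"
  proof (intro equalityI subsetI)
    fix w assume w: "w \<in> invariants G W \<sigma>"
    then obtain v where "v \<in> U" "w = f v"
      using sub(2) bij by (auto simp: bij_betw_def)
    with w iff show "w \<in> f ` invariants G U \<rho>" by blast
  qed (use iff sub(1) in blast)
  then have "bij_betw f (invariants G U \<rho>) (invariants G W \<sigma>)"
    using bij sub(1) by (auto simp: bij_betw_def intro: inj_on_subset)
  moreover have "linear_on s1 s2 (invariants G U \<rho>) (invariants G W \<sigma>) f"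
    using linear_onD(2,3)[OF lin] sub(1) bij_betw_imp_surj_on[OF calculation]
    by (simp add: linear_on_def subset_iff Pi_iff) blast
  ultimately show ?thesis
    by (simp add: linear_iso_on_def)
qed

section \<open>The averaging map of an \<open>FI\<^sub>W\<close>-module\<close>

lemma (in hom_module) map_closed: "\<phi> \<in> Hom m n \<Longrightarrow> v \<in> V m \<Longrightarrow> F m n \<phi> v \<in> V n"
  using map_linear linear_onD(1) by blast

lemma hom_module_group_rep:
  assumes "FI_module W scale V F"
  shows "group_rep (weyl_group W n) scale (V n) (F n n)"
proof -
  interpret hom_module "FI_hom W" scale V F by fact
  interpret group "weyl_group W n" by (rule group_weyl_group)
  show ?thesis
    by unfold_locales (simp_all add: space_subspace map_linear map_id map_comp)
qed

text \<open>For \<open>j g\<close> any extension of \<open>g\<close> to an element of the next Weyl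
  group will do: \<open>j g\<close> after the inclusion and the inclusion after \<open>g\<close> are
  the same morphism. The choice is harmless, as averaging absorbs the element chosen.\<close>

lemma FI_module_equivariant:
  assumes "FI_module W scale V F"
  shows "\<exists>j\<in>carrier (weyl_group W n) \<rightarrow> carrier (weyl_group W (Suc n)).
    equivariant (weyl_group W n) j (V n) (F n n) (F (Suc n) (Suc n)) (F n (Suc n) (id_incl n))"
proof -
  interpret hom_module "FI_hom W" scale V F by fact
  have incl: "id_incl n \<in> FI_hom W n (Suc n)" by (simp add: id_incl_FI_hom)
  have "\<exists>h\<in>FI_hom W (Suc n) (Suc n). h \<circ> id_incl n = g" if "g \<in> FI_hom W n n" for g
  proof -
    have "g \<in> FI_hom W n (Suc n)"
      using FI_hom_comp[OF that incl] id_incl_comp_FI_BC_hom[OF FI_hom_imp_BC[OF that]] by simp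
    then show ?thesis by (rule FI_hom_extend)
  qed
  then obtain j where j: "\<And>g. g \<in> FI_hom W n n \<Longrightarrow> j g \<in> FI_hom W (Suc n) (Suc n)"
    "\<And>g. g \<in> FI_hom W n n \<Longrightarrow> j g \<circ> id_incl n = g"
    by metis
  have "F n (Suc n) (id_incl n) (F n n g v) = F (Suc n) (Suc n) (j g) (F n (Suc n) (id_incl n) v)"
    if "g \<in> FI_hom W n n" "v \<in> V n" for g v
    using that j incl map_comp[of g n n "id_incl n" "Suc n" v]
      map_comp[of "id_incl n" n "Suc n" "j g" "Suc n" v]
      id_incl_comp_FI_BC_hom[OF FI_hom_imp_BC[OF that(1)]]
    by simp
  then show ?thesis
    using j(1) by (intro bexI[of _ j]) (auto simp: equivariant_def)
qed

text \<open>Each morphism from \<open>d\<close> to \<open>n + 1\<close> is a group element after the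
  standard inclusion, and for \<open>d \<le> n\<close> this inclusion passes through
  \<open>n\<close>. Hence the images of \<open>V d\<close> that span \<open>V (n + 1)\<close> are
  translates of elements coming from \<open>V n\<close>.\<close>

lemma generated_in_stage_group_span:
  assumes "FI_module W scale V F" "generated_in_stage W scale V F d" "d \<le> n"
  shows "group_span (weyl_group W (Suc n)) scale (F (Suc n) (Suc n))
    (F n (Suc n) (id_incl n) ` V n) = V (Suc n)"
proof -
  interpret hom_module "FI_hom W" scale V F by fact
  let ?i = "F n (Suc n) (id_incl n)"
  let ?S = "\<Union>g\<in>FI_hom W (Suc n) (Suc n). F (Suc n) (Suc n) g ` ?i ` V n"
  have incl: "id_incl n \<in> FI_hom W n (Suc n)" "id_incl d \<in> FI_hom W d n"
    "id_incl d \<in> FI_hom W d (Suc n)"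
    using assms(3) by (simp_all add: id_incl_FI_hom)
  have "F d (Suc n) \<phi> v \<in> ?S" if \<phi>: "\<phi> \<in> FI_hom W d (Suc n)" and v: "v \<in> V d" for \<phi> v
  proof -
    obtain g where g: "g \<in> FI_hom W (Suc n) (Suc n)" "g \<circ> id_incl d = \<phi>"
      using FI_hom_extend[OF \<phi>] by blast
    have "F d (Suc n) \<phi> v = F (Suc n) (Suc n) g (F d (Suc n) (id_incl d) v)"
      using map_comp[OF incl(3) g(1) v] g(2) by simp
    also have "F d (Suc n) (id_incl d) v = ?i (F d n (id_incl d) v)"
      using map_comp[OF incl(2,1) v] assms(3) by (simp add: id_incl_comp_id_incl)
    finally show ?thesis
      using g(1) map_closed[OF incl(2) v] by blast
  qed
  then have "(\<Union>\<phi>\<in>FI_hom W d (Suc n). F d (Suc n) \<phi> ` V d) \<subseteq> ?S" by blast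
  then have "V (Suc n) \<subseteq> span ?S"
    using assms(2,3) span_mono unfolding generated_in_stage_def by (metis le_SucI)
  moreover have "span ?S \<subseteq> V (Suc n)"
    using map_closed incl(1) by (intro span_minimal space_subspace) auto
  ultimately show ?thesis
    by (simp add: group_span_def)
qed

lemma averaging_map_surjective:
  fixes scale :: "'k::field_char_0 \<Rightarrow> 'v::ab_group_add \<Rightarrow> 'v"
  assumes "FI_module W scale V F" "generated_in_stage W scale V F d" "d \<le> n"
  shows "averaging_map W scale F n ` invariants (weyl_group W n) (V n) (F n n)
    = invariants (weyl_group W (Suc n)) (V (Suc n)) (F (Suc n) (Suc n))"
proof -
  interpret hom_module "FI_hom W" scale V F by fact
  obtain j where j: "j \<in> carrier (weyl_group W n) \<rightarrow> carrier (weyl_group W (Suc n))"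
    "equivariant (weyl_group W n) j (V n) (F n n) (F (Suc n) (Suc n)) (F n (Suc n) (id_incl n))"
    using FI_module_equivariant[OF assms(1)] by blast
  show ?thesis
    unfolding averaging_map_def
    by (rule averaging_surjective[OF hom_module_group_rep[OF assms(1)] _
          hom_module_group_rep[OF assms(1)] _ j(1) map_linear j(2)
          generated_in_stage_group_span[OF assms]])
       (simp_all add: id_incl_FI_hom)
qed

lemma averaging_map_linear_on:
  assumes "FI_module W scale V F"
  shows "linear_on scale scale (invariants (weyl_group W n) (V n) (F n n))
    (invariants (weyl_group W (Suc n)) (V (Suc n)) (F (Suc n) (Suc n))) (averaging_map W scale F n)"
proof -
  interpret hom_module "FI_hom W" scale V F by fact
  show ?thesis
    unfolding averaging_map_def
    by (rule averaging_linear_on[OF hom_module_group_rep[OF assms] map_linear])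
       (simp add: id_incl_FI_hom)
qed


section \<open>Injectivity for \<open>FI\<^sub>W#\<close>-modules\<close>

lemma FI_BC_hom_sharp: "FI_BC_hom m n \<subseteq> FI_BC_sharp_hom m n"
proof
  fix \<phi> assume \<phi>: "\<phi> \<in> FI_BC_hom m n"
  have "\<phi> ` {t, - t} = {\<phi> t, - \<phi> t}" for t
    by (simp add: FI_BC_hom_uminus[OF \<phi>])
  moreover have "\<phi> ` insert 0 (signed m) \<subseteq> insert 0 (signed n)"
    using FI_BC_hom_signed[OF \<phi>] FI_BC_hom_outside[OF \<phi>, of 0] by auto
  moreover have "inj_on \<phi> (signed m - \<phi> -` {0})"
    using FI_BC_hom_inj[OF \<phi>] by (rule inj_on_subset) auto
  ultimately show "\<phi> \<in> FI_BC_sharp_hom m n"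
    using FI_BC_hom_outside[OF \<phi>] unfolding FI_BC_sharp_hom_def by blast
qed

lemma FI_hom_sharp: "\<phi> \<in> FI_hom W m n \<Longrightarrow> \<phi> \<in> FI_sharp_hom W m n"
proof (cases "W = TypeA")
  case True
  assume \<phi>: "\<phi> \<in> FI_hom W m n"
  have BC: "\<phi> \<in> FI_BC_hom m n" using \<phi> by (rule FI_hom_imp_BC)
  have "\<phi> t \<in> {0..int n}" if "t \<in> {1..int m}" for t
  proof -
    have t: "t \<in> signed m" using that by (simp add: signed_iff)
    then have "sgn (\<phi> t) = sgn t" using \<phi> True by (simp add: FI_hom_iff)
    then have "\<phi> t > 0" using that by (simp add: sgn_if split: if_splits)
    then show ?thesis using FI_BC_hom_signed[OF BC t] by (simp add: signed_iff)
  qed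
  then show ?thesis
    using FI_BC_hom_sharp BC True by (auto simp: FI_sharp_hom_def)
next
  case False
  assume "\<phi> \<in> FI_hom W m n"
  then show ?thesis
    using FI_BC_hom_sharp FI_hom_imp_BC False unfolding FI_sharp_hom_def by (metis subsetD)
qed

lemma FI_sharp_module_underlying:
  assumes "FI_sharp_module W scale V F"
  shows "FI_module W scale V F"
proof -
  interpret hom_module "FI_sharp_hom W" scale V F by fact
  show ?thesis
    by unfold_locales
       (auto simp: space_subspace map_id intro: map_linear FI_hom_sharp map_comp[OF FI_hom_sharp FI_hom_sharp])
qed

text \<open>For \<open>m < k\<close> this morphism is no inclusion but a projection: it sends the
  elements of \<open>signed k\<close> outside \<open>signed m\<close> to the base point.\<close>

lemma id_incl_FI_sharp_hom: "m \<le> k \<Longrightarrow> m \<le> l \<Longrightarrow> id_incl m \<in> FI_sharp_hom W k l"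
  by (auto simp: FI_sharp_hom_def FI_BC_sharp_hom_def id_incl_def signed_iff inj_on_def)

text \<open>Lets the action of \<open>W_n\<close> be moved past the projection, so that the
  projection maps invariants to invariants. An extension \<open>h\<close> of \<open>g\<close> works,
  since \<open>g\<close> already fills \<open>signed n\<close> and so \<open>h\<close> must send the
  new pair outside it.\<close>

lemma FI_hom_extension_projection:
  assumes g: "g \<in> FI_hom W n n"
  shows "\<exists>h\<in>FI_hom W (Suc n) (Suc n). id_incl n \<circ> h = g"
proof -
  have BC: "g \<in> FI_BC_hom n n" using g by (rule FI_hom_imp_BC)
  have "g \<in> FI_hom W n (Suc n)"
    using FI_hom_comp[OF g id_incl_FI_hom[of n "Suc n"]] id_incl_comp_FI_BC_hom[OF BC] by simp
  then obtain h where h: "h \<in> FI_hom W (Suc n) (Suc n)" "h \<circ> id_incl n = g"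
    using FI_hom_extend by blast
  have hBC: "h \<in> FI_BC_hom (Suc n) (Suc n)" using h(1) by (rule FI_hom_imp_BC)
  have hg: "h t = g t" if "t \<in> signed n" for t
    using that h(2) by (auto simp: fun_eq_iff id_incl_def split: if_splits)
  have "id_incl n (h t) = g t" for t
  proof (cases "t \<in> signed n")
    case True
    then show ?thesis
      using FI_BC_hom_signed[OF BC True] by (simp add: hg id_incl_def)
  next
    case False
    have "h t \<notin> signed n"
    proof
      assume ht: "h t \<in> signed n"
      have "g ` signed n = signed n"
        using FI_BC_hom_bij_betw_iff[OF BC] by (simp add: bij_betw_def)
      then obtain s where s: "s \<in> signed n" "h s = h t"
        using ht hg by (metis imageE)
      moreover have "s \<in> signed (Suc n)" "t \<in> signed (Suc n)"
        using s(1) ht FI_BC_hom_outside[OF hBC, of t] by (auto simp: signed_iff)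
      ultimately have "s = t"
        using FI_BC_hom_inj[OF hBC] by (auto dest: inj_onD)
      with s False show False by simp
    qed
    then show ?thesis
      using FI_BC_hom_outside[OF BC False] by (simp add: id_incl_def)
  qed
  with h(1) show ?thesis by (auto simp: fun_eq_iff)
qed

text \<open>
  If \<open>g\<close> does not preserve \<open>signed n\<close>, then \<open>g\<close> restricted to \<open>signed n\<close> and projected
  back loses exactly one pair \<open>\<plusminus>b\<close>; up to the two actions of \<open>W\<^sub>n\<close> it is the projection
  onto \<open>signed (n - 1)\<close>.
\<close>

lemma FI_hom_compression:
  assumes W: "W \<noteq> TypeD" and g: "g \<in> FI_hom W (Suc n) (Suc n)"
    and bad: "\<not> g ` signed n \<subseteq> signed n"
  shows "\<exists>h\<in>FI_hom W n n. \<exists>k\<in>FI_hom W n n.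
    id_incl n \<circ> g \<circ> id_incl n \<circ> k = h \<circ> id_incl (n - 1)"
proof -
  have BC: "g \<in> FI_BC_hom (Suc n) (Suc n)" using g by (rule FI_hom_imp_BC)
  have mono: "t \<in> signed (Suc n)" if "t \<in> signed n" for t using that by (simp add: signed_iff)
  obtain b where b: "b \<in> signed n" "g b \<notin> signed n" using bad by blast
  have gb: "\<bar>g b\<bar> = int n + 1"
    using FI_BC_hom_signed[OF BC mono[OF b(1)]] b(2) by (auto simp: signed_iff)
  have n: "n \<ge> 1" using b(1) by (auto simp: signed_iff)
  \<comment> \<open>The permutation \<open>k\<close> carries \<open>\<plusminus>n\<close> to the
    lost pair \<open>\<plusminus>b\<close>, so that after inserting \<open>k\<close> the pair that
    is killed is \<open>\<plusminus>n\<close>.\<close>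
  define \<tau> where "\<tau> = transpose \<bar>b\<bar> (int n)"
  have \<tau>: "\<tau> permutes {1..int n}"
    unfolding \<tau>_def using b(1) n by (intro permutes_swap_id) (auto simp: signed_iff)
  define k where "k = signed_perm n (\<lambda>_. 1) \<tau>"
  have \<tau>2: "inj_on \<tau> {1..int n}" "\<tau> ` {1..int n} \<subseteq> {1..int n}"
    using permutes_inj_on[OF \<tau>] permutes_image[OF \<tau>] by auto
  have kBC: "k \<in> FI_BC_hom n n"
    unfolding k_def by (rule signed_perm_BC[OF \<tau>2]) simp
  have "sgn (k t) = sgn t" if "t \<in> signed n" for t
    unfolding k_def using sgn_signed_perm[OF \<tau>2 _ that, of "\<lambda>_. 1"] by simp
  then have k: "k \<in> FI_hom W n n"
    using kBC W by (cases W) (auto simp: FI_hom_iff)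
  have kn: "\<bar>k t\<bar> = \<bar>b\<bar> \<longleftrightarrow> \<bar>t\<bar> = int n" if "t \<in> signed n" for t
  proof -
    have "k (int n) = \<bar>b\<bar>"
      using n by (simp add: k_def signed_perm_def signed_iff \<tau>_def)
    moreover have "int n \<in> signed n" using n by (simp add: signed_iff)
    ultimately show ?thesis
      using FI_BC_hom_abs_eq_iff[OF kBC that, of "int n"] by simp
  qed
  have gn: "g t \<in> signed n \<longleftrightarrow> \<bar>t\<bar> \<noteq> \<bar>b\<bar>" if "t \<in> signed n" for t
    using FI_BC_hom_abs_eq_iff[OF BC mono[OF that] mono[OF b(1)]] gb
      FI_BC_hom_signed[OF BC mono[OF that]]
    by (auto simp: signed_iff)
  define \<phi> where "\<phi> = id_incl n \<circ> g \<circ> id_incl n \<circ> k"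
  \<comment> \<open>Exactly \<open>\<plusminus>n\<close> is sent to 0. Hence \<open>\<phi>\<close>
    is a morphism from \<open>n - 1\<close> to \<open>n\<close>, and extending it produces
    \<open>h\<close>.\<close>
  have \<phi>_eq: "\<phi> t = (if t \<in> signed (n - 1) then g (k t) else 0)" for t
  proof (cases "t \<in> signed n")
    case True
    have "\<bar>t\<bar> = int n \<longleftrightarrow> t \<notin> signed (n - 1)"
      using True n by (auto simp: signed_iff)
    then show ?thesis
      using kn[OF True] gn[OF FI_BC_hom_signed[OF kBC True]] FI_BC_hom_signed[OF kBC True]
      by (auto simp: \<phi>_def id_incl_def)
  next
    case False
    then have "t \<notin> signed (n - 1)" by (auto simp: signed_iff)
    moreover have "g 0 = 0" using FI_BC_hom_outside[OF BC, of 0] by simp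
    ultimately show ?thesis
      using FI_BC_hom_outside[OF kBC False] by (simp add: \<phi>_def id_incl_def)
  qed
  have "k \<in> FI_hom W n (Suc n)"
    using FI_hom_comp[OF k id_incl_FI_hom[of n "Suc n"]] by (simp add: id_incl_comp_FI_BC_hom[OF kBC])
  then have \<phi>': "g \<circ> k \<in> FI_hom W n (Suc n)"
    using g by (rule FI_hom_comp)
  have gkBC: "g \<circ> k \<in> FI_BC_hom n (Suc n)" using \<phi>' by (rule FI_hom_imp_BC)
  have sub: "t \<in> signed n" if "t \<in> signed (n - 1)" for t using that by (auto simp: signed_iff)
  have \<phi>BC: "\<phi> \<in> FI_BC_hom (n - 1) n"
  proof (rule FI_BC_homI)
    fix t assume t: "t \<in> signed (n - 1)"
    have "\<bar>t\<bar> \<noteq> int n" using t n by (auto simp: signed_iff)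
    then show "\<phi> t \<in> signed n"
      using gn[OF FI_BC_hom_signed[OF kBC sub[OF t]]] kn[OF sub[OF t]] t by (simp add: \<phi>_eq)
    show "\<phi> (- t) = - \<phi> t"
      using FI_BC_hom_uminus[OF gkBC, of t] t by (simp add: \<phi>_eq signed_iff)
  next
    fix s t assume "s \<in> signed (n - 1)" "t \<in> signed (n - 1)" "\<phi> s = \<phi> t"
    then show "s = t"
      using inj_onD[OF FI_BC_hom_inj[OF gkBC], of s t] sub by (simp add: \<phi>_eq)
  qed (simp add: \<phi>_eq)
  have "\<phi> \<in> FI_hom W (n - 1) n"
  proof (cases W)
    case TypeA
    then have "sgn (g (k t)) = sgn t" if "t \<in> signed n" for t
      using \<phi>' that by (simp add: FI_hom_iff)
    then show ?thesis
      using TypeA \<phi>BC sub by (simp add: FI_hom_iff \<phi>_eq)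
  qed (use W \<phi>BC in \<open>auto simp: FI_hom_iff\<close>)
  then obtain h where "h \<in> FI_hom W n n" "h \<circ> id_incl (n - 1) = \<phi>"
    using FI_hom_extend by blast
  with k show ?thesis
    by (metis \<phi>_def)
qed

section \<open>The averaging map projected back to level n\<close>

context
  fixes W :: weyl_type and scale :: "'k::field_char_0 \<Rightarrow> 'v::ab_group_add \<Rightarrow> 'v" and V F
  assumes sharp: "FI_sharp_module W scale V F" and W: "W \<noteq> TypeD"
begin

interpretation hom_module "FI_sharp_hom W" scale V F by (rule sharp)

interpretation rep: group_rep "weyl_group W n" scale "V n" "F n n" for n
  by (rule hom_module_group_rep[OF FI_sharp_module_underlying[OF sharp]])

abbreviation (input) Inv :: "nat \<Rightarrow> 'v set"
  where "Inv n \<equiv> invariants (weyl_group W n) (V n) (F n n)"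

definition proj_map :: "nat \<Rightarrow> 'v \<Rightarrow> 'v"
  where "proj_map n v = F (Suc n) n (id_incl n) v"

text \<open>The averaging map without its factor \<open>1 / \<bar>W_{n+1}\<bar>\<close>, which keeps
  all coefficients below natural numbers.\<close>

definition orbit_sum :: "nat \<Rightarrow> 'v \<Rightarrow> 'v"
  where "orbit_sum n v =
    (\<Sum>g\<in>FI_hom W (Suc n) (Suc n). F (Suc n) (Suc n) g (F n (Suc n) (id_incl n) v))"

text \<open>Projects to level \<open>n - 1\<close>, includes back into level \<open>n\<close>, and
  sums over the group. At \<open>n = 0\<close> the truncated \<open>n - 1\<close> is again 0; there
  the term occurs only with coefficient 0.\<close>

definition compressed_sum :: "nat \<Rightarrow> 'v \<Rightarrow> 'v"
  where "compressed_sum n v = (\<Sum>h\<in>FI_hom W n n. F n n h (F n n (id_incl (n - 1)) v))"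

definition moving :: "nat \<Rightarrow> (int \<Rightarrow> int) set"
  where "moving n = {g \<in> FI_hom W (Suc n) (Suc n). \<not> g ` signed n \<subseteq> signed n}"

lemma InvD: "v \<in> Inv n \<Longrightarrow> v \<in> V n" "v \<in> Inv n \<Longrightarrow> g \<in> FI_hom W n n \<Longrightarrow> F n n g v = v"
  by (auto simp: invariants_def)

lemma incl_closed: "v \<in> V n \<Longrightarrow> F n (Suc n) (id_incl n) v \<in> V (Suc n)"
  by (rule map_closed) (simp add: id_incl_FI_sharp_hom)

lemma proj_map_linear: "linear_on scale scale (V (Suc n)) (V n) (proj_map n)"
  using map_linear[OF id_incl_FI_sharp_hom[of n "Suc n" n W]]
  by (simp add: linear_on_def proj_map_def Pi_iff)

lemma proj_map_Inv:
  assumes "v \<in> Inv (Suc n)"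
  shows "proj_map n v \<in> Inv n"
proof -
  have v: "v \<in> V (Suc n)" using assms by (rule InvD)
  have "F n n g (proj_map n v) = proj_map n v" if g: "g \<in> FI_hom W n n" for g
  proof -
    have i: "id_incl n \<in> FI_sharp_hom W (Suc n) n" by (simp add: id_incl_FI_sharp_hom)
    obtain h where h: "h \<in> FI_hom W (Suc n) (Suc n)" "id_incl n \<circ> h = g"
      using FI_hom_extension_projection[OF g] by blast
    have "F n n g (proj_map n v) = F (Suc n) n (g \<circ> id_incl n) v"
      using map_comp[OF i FI_hom_sharp[OF g] v] by (simp add: proj_map_def)
    also have "g \<circ> id_incl n = id_incl n \<circ> h"
      using h(2) FI_BC_hom_comp_id_incl[OF FI_hom_imp_BC[OF g]] by simp
    also have "F (Suc n) n (id_incl n \<circ> h) v = proj_map n v"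
      using map_comp[OF FI_hom_sharp[OF h(1)] i v] InvD(2)[OF assms h(1)] by (simp add: proj_map_def)
    finally show ?thesis .
  qed
  then show ?thesis
    using linear_onD(1)[OF proj_map_linear v] by (simp add: invariants_def)
qed

lemma orbit_sum_Inv: "v \<in> V n \<Longrightarrow> orbit_sum n v \<in> Inv (Suc n)"
  using rep.sum_act_invariants[OF incl_closed] by (simp add: orbit_sum_def)

text \<open>The link between consecutive levels, and the source of the products \<open>A B\<close>
  and \<open>B A\<close>: the projection that forgets one pair factors through level
  \<open>n\<close>.\<close>

lemma compressed_sum_Suc:
  assumes "v \<in> V (Suc n)"
  shows "compressed_sum (Suc n) v = orbit_sum n (proj_map n v)"
proof -
  have "F (Suc n) (Suc n) (id_incl n) v = F n (Suc n) (id_incl n) (F (Suc n) n (id_incl n) v)"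
    using map_comp[of "id_incl n" "Suc n" n "id_incl n" "Suc n" v] assms
    by (simp add: id_incl_FI_sharp_hom id_incl_comp_id_incl)
  then show ?thesis
    by (simp add: compressed_sum_def orbit_sum_def proj_map_def)
qed

text \<open>The restriction of \<open>g\<close> to \<open>signed n\<close> is an element of
  \<open>W_n\<close> and therefore fixes \<open>v\<close>. In type D it could have the wrong parity,
  compensated in \<open>g\<close> by the sign at \<open>n + 1\<close>.\<close>

lemma proj_act_incl_fixed:
  assumes v: "v \<in> Inv n" and g: "g \<in> FI_hom W (Suc n) (Suc n)" and stable: "g ` signed n \<subseteq> signed n"
  shows "proj_map n (F (Suc n) (Suc n) g (F n (Suc n) (id_incl n) v)) = v"
proof -
  have vV: "v \<in> V n" using v by (rule InvD)
  have BC: "g \<in> FI_BC_hom (Suc n) (Suc n)" using g by (rule FI_hom_imp_BC)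
  have sub: "t \<in> signed (Suc n)" if "t \<in> signed n" for t using that by (simp add: signed_iff)
  have gi: "g \<circ> id_incl n \<in> FI_hom W n (Suc n)"
    using id_incl_FI_hom g by (rule FI_hom_comp) simp
  let ?q = "id_incl n \<circ> (g \<circ> id_incl n)"
  have q_eq: "?q t = (if t \<in> signed n then g t else 0)" for t
    using stable FI_BC_hom_outside[OF BC, of 0] by (auto simp: id_incl_def)
  have qBC: "?q \<in> FI_BC_hom n n"
  proof (rule FI_BC_homI)
    fix t assume t: "t \<in> signed n"
    show "?q t \<in> signed n" using t stable by (auto simp only: q_eq if_True)
    show "?q (- t) = - ?q t"
      using t FI_BC_hom_uminus[OF BC, of t] by (simp only: q_eq) (simp add: signed_iff)
  next
    fix s t assume "s \<in> signed n" "t \<in> signed n" "?q s = ?q t"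
    then show "s = t"
      using inj_onD[OF FI_BC_hom_inj[OF BC], of s t] sub by (simp only: q_eq if_True)
  qed (simp only: q_eq if_False)
  have "?q \<in> FI_hom W n n"
  proof (cases W)
    case TypeA
    then have "sgn (g t) = sgn t" if "t \<in> signed n" for t
      using g sub[OF that] by (simp add: FI_hom_iff)
    then have "\<forall>t\<in>signed n. sgn (?q t) = sgn t"
      by (simp only: q_eq if_True) simp
    then show ?thesis
      using TypeA qBC by (simp only: FI_hom_iff)
  qed (use W qBC in \<open>simp_all add: FI_hom_iff\<close>)
  then have "F n n ?q v = v"
    by (rule InvD(2)[OF v])
  moreover have "F (Suc n) (Suc n) g (F n (Suc n) (id_incl n) v) = F n (Suc n) (g \<circ> id_incl n) v"
    using map_comp[OF _ FI_hom_sharp[OF g] vV] by (simp add: id_incl_FI_sharp_hom)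
  ultimately show ?thesis
    using map_comp[OF FI_hom_sharp[OF gi] _ vV, of "id_incl n" n]
    by (simp add: id_incl_FI_sharp_hom proj_map_def)
qed

text \<open>Invariance allows \<open>v\<close> to be replaced by its image under the
  \<open>k\<close> of \<open>FI_hom_compression\<close>; the composite morphism is then
  \<open>h\<close> after the projection onto \<open>signed (n - 1)\<close>.\<close>

lemma proj_act_incl_moving:
  assumes v: "v \<in> Inv n" and g: "g \<in> moving n"
  shows "\<exists>h\<in>FI_hom W n n. proj_map n (F (Suc n) (Suc n) g (F n (Suc n) (id_incl n) v))
    = F n n h (F n n (id_incl (n - 1)) v)"
proof -
  have vV: "v \<in> V n" using v by (rule InvD)
  have g': "g \<in> FI_hom W (Suc n) (Suc n)" using g by (simp add: moving_def)
  obtain h k where hk: "h \<in> FI_hom W n n" "k \<in> FI_hom W n n"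
    "id_incl n \<circ> g \<circ> id_incl n \<circ> k = h \<circ> id_incl (n - 1)"
    using FI_hom_compression[OF W g'] g by (auto simp: moving_def)
  have ik: "id_incl n \<circ> k \<in> FI_hom W n (Suc n)"
    using hk(2) id_incl_FI_hom by (rule FI_hom_comp) simp
  have gik: "g \<circ> (id_incl n \<circ> k) \<in> FI_hom W n (Suc n)"
    using ik g' by (rule FI_hom_comp)
  have "F n (Suc n) (id_incl n) v = F n (Suc n) (id_incl n \<circ> k) v"
    using map_comp[OF FI_hom_sharp[OF hk(2)] _ vV, of "id_incl n" "Suc n"] InvD(2)[OF v hk(2)]
    by (simp add: id_incl_FI_sharp_hom)
  then have "proj_map n (F (Suc n) (Suc n) g (F n (Suc n) (id_incl n) v))
      = F (Suc n) n (id_incl n) (F n (Suc n) (g \<circ> (id_incl n \<circ> k)) v)"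
    using map_comp[OF FI_hom_sharp[OF ik] FI_hom_sharp[OF g'] vV] by (simp add: proj_map_def)
  also have "\<dots> = F n n (h \<circ> id_incl (n - 1)) v"
    using map_comp[OF FI_hom_sharp[OF gik] _ vV, of "id_incl n" n] hk(3)
    by (simp add: id_incl_FI_sharp_hom comp_assoc)
  also have "\<dots> = F n n h (F n n (id_incl (n - 1)) v)"
    using map_comp[OF _ FI_hom_sharp[OF hk(1)] vV] by (simp add: id_incl_FI_sharp_hom)
  finally show ?thesis
    using hk(1) by blast
qed

text \<open>The element \<open>h\<close> that a moving \<open>g\<close> leaves behind depends on
  \<open>g\<close>. Summing once more over \<open>W_n\<close> removes it, and multiplies the left
  side, being invariant already, by \<open>\<bar>W_n\<bar>\<close>. Every moving \<open>g\<close>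
  then contributes the same \<open>compressed_sum\<close>, and every other \<open>g\<close>
  contributes \<open>\<bar>W_n\<bar>\<close> times \<open>v\<close>.\<close>

lemma proj_orbit_sum:
  assumes v: "v \<in> Inv n"
  shows "scale (of_nat (card (FI_hom W n n))) (proj_map n (orbit_sum n v)) =
    scale (of_nat (card (FI_hom W (Suc n) (Suc n) - moving n) * card (FI_hom W n n))) v
    + scale (of_nat (card (moving n))) (compressed_sum n v)"
proof -
  let ?G = "FI_hom W (Suc n) (Suc n)" and ?H = "FI_hom W n n"
  let ?X = "\<lambda>g. proj_map n (F (Suc n) (Suc n) g (F n (Suc n) (id_incl n) v))"
  have vV: "v \<in> V n" using v by (rule InvD)
  have gV: "F (Suc n) (Suc n) g (F n (Suc n) (id_incl n) v) \<in> V (Suc n)" if "g \<in> ?G" for g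
    using that by (intro map_closed[OF FI_hom_sharp] incl_closed vV)
  then have X: "?X g \<in> V n" if "g \<in> ?G" for g
    using that linear_onD(1)[OF proj_map_linear] by blast
  have S: "proj_map n (orbit_sum n v) = (\<Sum>g\<in>?G. ?X g)"
    unfolding orbit_sum_def using gV
    by (rule linear_on_sum[OF vector_space_axioms vector_space_axioms space_subspace proj_map_linear])
  have inner: "(\<Sum>k\<in>?H. F n n k (?X g))
      = (if g \<in> moving n then compressed_sum n v else scale (of_nat (card ?H)) v)" if g: "g \<in> ?G" for g
  proof (cases "g \<in> moving n")
    case True
    then obtain h where h: "h \<in> ?H" "?X g = F n n h (F n n (id_incl (n - 1)) v)"
      using proj_act_incl_moving[OF v] by blast
    have "F n n (id_incl (n - 1)) v \<in> V n"
      by (rule map_closed[OF _ vV]) (simp add: id_incl_FI_sharp_hom)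
    with h show ?thesis
      using True rep.sum_act_translate[of h n] by (simp add: compressed_sum_def)
  next
    case False
    then have "?X g = v"
      using proj_act_incl_fixed[OF v g] g by (simp add: moving_def)
    then show ?thesis
      using False InvD(2)[OF v] by (simp add: sum_constant_scale)
  qed
  have "scale (of_nat (card ?H)) (proj_map n (orbit_sum n v))
      = (\<Sum>k\<in>?H. F n n k (proj_map n (orbit_sum n v)))"
    using InvD(2)[OF proj_map_Inv[OF orbit_sum_Inv[OF vV]]] by (simp add: sum_constant_scale)
  also have "\<dots> = (\<Sum>k\<in>?H. \<Sum>g\<in>?G. F n n k (?X g))"
    unfolding S using X by (intro sum.cong refl rep.act_sum) auto
  also have "\<dots> = (\<Sum>g\<in>?G. \<Sum>k\<in>?H. F n n k (?X g))"
    by (rule sum.swap)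
  also have "\<dots> = (\<Sum>g\<in>?G. if g \<in> moving n then compressed_sum n v else scale (of_nat (card ?H)) v)"
    by (intro sum.cong refl inner)
  also have "\<dots> = (\<Sum>g\<in>moving n. compressed_sum n v) + (\<Sum>g\<in>?G - moving n. scale (of_nat (card ?H)) v)"
    by (subst sum.If_cases) (auto simp: moving_def Int_def intro!: arg_cong2[where f = "(+)"] sum.cong)
  also have "\<dots> = scale (of_nat (card (?G - moving n) * card ?H)) v
      + scale (of_nat (card (moving n))) (compressed_sum n v)"
    by (simp add: sum_constant_scale add.commute)
  finally show ?thesis .
qed

lemma card_fixing_pos: "card (FI_hom W (Suc n) (Suc n) - moving n) > 0"
proof -
  have "id_incl (Suc n) \<in> FI_hom W (Suc n) (Suc n) - moving n"
    by (auto simp: moving_def id_incl_FI_hom id_incl_def signed_iff)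
  then show ?thesis by (auto simp: card_gt_0_iff)
qed

text \<open>The hypothesis says, for \<open>x > 0\<close>, that \<open>v\<close> has the eigenvalue
  \<open>-y/x\<close>. Multiplying by \<open>\<bar>W_n\<bar>\<close> and inserting
  \<open>proj_orbit_sum\<close> shifts this eigenvalue: the new coefficient of \<open>v\<close> is
  positive even for \<open>y = 0\<close>.\<close>

lemma compressed_sum_eigenvector:
  assumes v: "v \<in> Inv n"
    and eq: "scale (of_nat x) (proj_map n (orbit_sum n v)) + scale (of_nat y) v = 0"
  shows "scale (of_nat (x * card (moving n))) (compressed_sum n v)
    + scale (of_nat ((x * card (FI_hom W (Suc n) (Suc n) - moving n) + y) * card (FI_hom W n n))) v = 0"
    (is "?a + ?b = 0")
proof -
  let ?w = "of_nat (card (FI_hom W n n)) :: 'k"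
  have "0 = scale ?w (scale (of_nat x) (proj_map n (orbit_sum n v)) + scale (of_nat y) v)"
    by (simp add: eq)
  also have "\<dots> = scale (of_nat x) (scale ?w (proj_map n (orbit_sum n v))) + scale (?w * of_nat y) v"
    by (simp add: scale_right_distrib mult.commute)
  also have "\<dots> = ?a + ?b"
    unfolding proj_orbit_sum[OF v]
    by (simp add: scale_right_distrib scale_left_distrib algebra_simps)
  finally show ?thesis by simp
qed

text \<open>
  All eigenvalues of \<open>proj_map n \<circ> orbit_sum n\<close> on the invariants are positive: by
  \<open>proj_orbit_sum\<close> they arise from those of \<open>orbit_sum (n - 1) \<circ> proj_map (n - 1)\<close>, whose
  nonzero eigenvalues are eigenvalues of \<open>proj_map (n - 1) \<circ> orbit_sum (n - 1)\<close>.
\<close>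

lemma proj_orbit_sum_no_nonpos_eigenvalue:
  assumes "v \<in> Inv n" "x > 0"
    and "scale (of_nat x) (proj_map n (orbit_sum n v)) + scale (of_nat y) v = 0"
  shows "v = 0"
  using assms
proof (induction n arbitrary: v x y)
  case (0 v x y)
  \<comment> \<open>As \<open>signed 0\<close> is empty, no element moves it; only a positive
    multiple of \<open>v\<close> remains in the equation.\<close>
  have "moving 0 = {}" by (auto simp: moving_def signed_iff)
  moreover have "card (FI_hom W 0 0) > 0"
    using id_incl_FI_hom[of 0 0 W] by (auto simp: card_gt_0_iff)
  ultimately show ?case
    using compressed_sum_eigenvector[OF 0(1,3)] card_fixing_pos[of 0] \<open>x > 0\<close>
    by (auto simp del: of_nat_mult of_nat_add)
next
  case (Suc n v x y)
  define a where "a = x * card (moving (Suc n))"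
  define b where "b = (x * card (FI_hom W (Suc (Suc n)) (Suc (Suc n)) - moving (Suc n)) + y)
    * card (FI_hom W (Suc n) (Suc n))"
  have "card (FI_hom W (Suc n) (Suc n)) > 0"
    using id_incl_FI_hom[of "Suc n" "Suc n" W] by (auto simp: card_gt_0_iff)
  then have "b > 0"
    using card_fixing_pos[of "Suc n"] \<open>x > 0\<close>
    unfolding b_def by (intro mult_pos_pos add_pos_nonneg) auto
  then have b: "(of_nat b :: 'k) \<noteq> 0" by simp
  let ?u = "proj_map n v"
  have vV: "v \<in> V (Suc n)" using Suc.prems(1) by (rule InvD)
  have u: "?u \<in> Inv n" using Suc.prems(1) by (rule proj_map_Inv)
  have uV: "?u \<in> V n" using u by (rule InvD)
  have SuV: "orbit_sum n ?u \<in> V (Suc n)"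
    using orbit_sum_Inv[OF uV] by (rule InvD)
  have eq: "scale (of_nat a) (orbit_sum n ?u) + scale (of_nat b) v = 0"
    using compressed_sum_eigenvector[OF Suc.prems(1,3)] compressed_sum_Suc[OF vV]
    unfolding a_def b_def by simp
  show ?case
  proof (cases "a = 0")
    case True
    then show ?thesis using eq b by simp
  next
    case False
    have p0: "proj_map n 0 = 0"
      using linear_onD(3)[OF proj_map_linear vV, of 0] by simp
    \<comment> \<open>Here \<open>A B\<close> becomes \<open>B A\<close>: applying
      \<open>proj_map n\<close> to the equation for \<open>v\<close> yields one for
      \<open>?u\<close>, a level lower, with coefficients \<open>a > 0\<close> and
      \<open>b\<close>.\<close>
    have "scale (of_nat a) (proj_map n (orbit_sum n ?u)) + scale (of_nat b) ?u
        = proj_map n (scale (of_nat a) (orbit_sum n ?u) + scale (of_nat b) v)"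
      using vV SuV subspace_scale[OF space_subspace] by (simp add: linear_onD[OF proj_map_linear])
    also have "\<dots> = 0" by (simp add: eq p0)
    finally have "?u = 0"
      using Suc.IH[OF u] False by blast
    moreover have "orbit_sum n 0 = 0"
    proof -
      have "0 \<in> V n" by (rule subspace_0[OF space_subspace])
      then have "F n (Suc n) (id_incl n) 0 = 0"
        using linear_onD(3)[OF map_linear, of "id_incl n" n "Suc n" 0 0] by (simp add: id_incl_FI_sharp_hom)
      moreover have "F (Suc n) (Suc n) g 0 = 0" if "g \<in> FI_hom W (Suc n) (Suc n)" for g
        using rep.act_sum[of g "Suc n" "{}"] that by simp
      ultimately show ?thesis by (simp add: orbit_sum_def)
    qed
    ultimately show ?thesis using eq b by simp
  qed
qed

lemma sharp_averaging_map_injective: "inj_on (averaging_map W scale F n) (Inv n)"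
proof (rule linear_on_inj_onI[OF vector_space_axioms vector_space_axioms rep.subspace_invariants
      averaging_map_linear_on[OF FI_sharp_module_underlying[OF sharp]]])
  fix v assume v: "v \<in> Inv n" "averaging_map W scale F n v = 0"
  have "card (FI_hom W (Suc n) (Suc n)) \<noteq> 0"
    using id_incl_FI_hom[of "Suc n" "Suc n" W] by auto
  then have "orbit_sum n v = 0"
    using v(2) by (simp add: averaging_map_def average_def orbit_sum_def)
  moreover have "0 \<in> V (Suc n)"
    by (rule subspace_0[OF space_subspace])
  then have "proj_map n 0 = 0"
    using linear_onD(3)[OF proj_map_linear, of 0 n 0] by simp
  \<comment> \<open>A vector killed by averaging has eigenvalue 0, which is the case
    \<open>x = 1\<close>, \<open>y = 0\<close>.\<close>
  ultimately show "v = 0"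
    using proj_orbit_sum_no_nonpos_eigenvalue[OF v(1), of 1 0] by simp
qed

end

section \<open>Invariants of the representations \<open>V(\<mu>)\<^sub>n\<close>\<close>

subsection \<open>Characters and left ideals of a group algebra\<close>

lemma sum_apply: "(\<Sum>a\<in>A. f a) h = (\<Sum>a\<in>A. f a h)"
  by (induction A rule: infinite_finite_induct) simp_all

lemma vector_space_fun_scale: "vector_space fun_scale"
  by unfold_locales (auto simp: fun_scale_def fun_eq_iff algebra_simps)

text \<open>The linear extension of a character to the group algebra; for \<open>\<chi> = 1\<close>
  it is the augmentation.\<close>

definition char_sum :: "('g, 'm) monoid_scheme \<Rightarrow> ('g \<Rightarrow> 'k::field) \<Rightarrow> ('g \<Rightarrow> 'k) \<Rightarrow> 'k"
  where "char_sum G \<chi> f = (\<Sum>h\<in>carrier G. \<chi> h * f h)"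

definition const_fun :: "('g, 'm) monoid_scheme \<Rightarrow> 'k::field \<Rightarrow> 'g \<Rightarrow> 'k"
  where "const_fun G c h = (if h \<in> carrier G then c else 0)"

context group
begin

lemma char_sum_left_mult:
  assumes "\<And>g h. g \<in> carrier G \<Longrightarrow> h \<in> carrier G \<Longrightarrow> \<chi> (g \<otimes> h) = \<chi> g * \<chi> h" "g \<in> carrier G"
  shows "char_sum G \<chi> (left_mult G g f) = \<chi> g * char_sum G \<chi> f"
proof -
  have "char_sum G \<chi> (left_mult G g f) = (\<Sum>h\<in>carrier G. \<chi> (g \<otimes> h) * f h)"
    unfolding char_sum_def left_mult_def
    using assms(2)
    by (intro sum.reindex_bij_witness[of _ "\<lambda>h. g \<otimes> h" "\<lambda>h. inv g \<otimes> h"])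
       (auto simp: m_assoc[symmetric])
  also have "\<dots> = \<chi> g * char_sum G \<chi> f"
    using assms by (simp add: char_sum_def sum_distrib_left mult.assoc)
  finally show ?thesis .
qed

text \<open>Left translation by \<open>g\<close> multiplies the character sum by
  \<open>\<chi> g\<close>, so its vanishing at the generator spreads to the whole ideal.\<close>

lemma left_ideal_char_sum:
  assumes "\<And>g h. g \<in> carrier G \<Longrightarrow> h \<in> carrier G \<Longrightarrow> \<chi> (g \<otimes> h) = \<chi> g * \<chi> h"
    and "char_sum G \<chi> x = 0" "f \<in> group_span G fun_scale (left_mult G) {x}"
  shows "char_sum G \<chi> f = 0"
proof -
  interpret vector_space fun_scale by (rule vector_space_fun_scale)
  have "f \<in> span (\<Union>g\<in>carrier G. left_mult G g ` {x})"
    using assms(3) by (simp add: group_span_def)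
  then show ?thesis
  proof (induction rule: span_induct_alt)
    case base
    show ?case by (simp add: char_sum_def)
  next
    case (step c y z)
    then have "char_sum G \<chi> y = 0"
      using char_sum_left_mult[OF assms(1)] assms(2) by auto
    moreover have "char_sum G \<chi> (fun_scale c y + z) = c * char_sum G \<chi> y + char_sum G \<chi> z"
      by (simp add: char_sum_def fun_scale_def sum.distrib sum_distrib_left algebra_simps)
    ultimately show ?case using step by (simp only: mult_zero_right add_0)
  qed
qed

lemma left_ideal_support:
  assumes "f \<in> group_span G fun_scale (left_mult G) {x}" "h \<notin> carrier G"
  shows "f h = 0"
proof -
  interpret vector_space fun_scale by (rule vector_space_fun_scale)
  have "f \<in> span (\<Union>g\<in>carrier G. left_mult G g ` {x})"
    using assms(1) by (simp add: group_span_def)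
  then show ?thesis
    by (induction rule: span_induct_alt) (auto simp: fun_scale_def left_mult_def assms(2))
qed

text \<open>The sum of all translates of \<open>x\<close> is the constant function whose value is
  the coefficient sum of \<open>x\<close>; dividing by that sum gives every constant.\<close>

lemma const_fun_in_left_ideal:
  assumes "char_sum G (\<lambda>_. 1) x \<noteq> 0"
  shows "const_fun G c \<in> group_span G fun_scale (left_mult G) {x}"
proof -
  interpret vector_space fun_scale by (rule vector_space_fun_scale)
  let ?s = "char_sum G (\<lambda>_. 1) x"
  have "(\<Sum>g\<in>carrier G. left_mult G g x) h = const_fun G ?s h" for h
  proof (cases "h \<in> carrier G")
    case True
    then have "(\<Sum>g\<in>carrier G. x (inv g \<otimes> h)) = (\<Sum>g\<in>carrier G. x g)"
      by (intro sum.reindex_bij_witness[of _ "\<lambda>g. h \<otimes> inv g" "\<lambda>g. inv g \<otimes> h"])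
         (auto simp: inv_mult_group m_assoc[symmetric], auto simp: m_assoc)
    then show ?thesis
      using True unfolding sum_apply by (simp add: const_fun_def char_sum_def left_mult_def)
  qed (simp add: sum_apply const_fun_def left_mult_def)
  then have "const_fun G c = fun_scale (c / ?s) (\<Sum>g\<in>carrier G. left_mult G g x)"
    using assms by (auto simp: fun_eq_iff fun_scale_def const_fun_def)
  also have "\<dots> \<in> span (\<Union>g\<in>carrier G. left_mult G g ` {x})"
    by (intro span_scale span_sum span_base) auto
  finally show ?thesis by (simp add: group_span_def)
qed

lemma left_mult_const_fun: "g \<in> carrier G \<Longrightarrow> left_mult G g (const_fun G c) = const_fun G c"
  by (auto simp: left_mult_def const_fun_def fun_eq_iff)

end


subsection \<open>Character sums of symmetrizers\<close>

lemma FI_hom_ambient: "g \<in> FI_hom W m n \<Longrightarrow> g \<in> FI_hom (ambient_type W) m n"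
  by (cases W) (simp_all add: ambient_type_def FI_hom_iff)

lemma FI_hom_TypeA_ambient: "g \<in> FI_hom TypeA m n \<Longrightarrow> g \<in> FI_hom (ambient_type W) m n"
  by (cases W) (simp_all add: ambient_type_def FI_hom_iff)

lemma sign_changes_ambient: "s \<in> sign_changes W n \<Longrightarrow> s \<in> FI_hom (ambient_type W) n n"
  by (auto simp: ambient_type_def sign_changes_def FI_hom_TypeBC id_incl_FI_hom)

text \<open>A character extends to an algebra homomorphism, so its value at a product of three
  elements of the group algebra is the product of its values. In coordinates, the sum over
  \<open>h\<close> is moved innermost, where only \<open>h = p \<circ> q \<circ> s\<close>
  survives.\<close>

lemma char_sum_symmetrizer:
  fixes \<chi> :: "(int \<Rightarrow> int) \<Rightarrow> 'k::field"
  assumes "\<And>g h. g \<in> FI_hom (ambient_type W) n n \<Longrightarrow> h \<in> FI_hom (ambient_type W) n n \<Longrightarrow>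
      \<chi> (g \<circ> h) = \<chi> g * \<chi> h"
  shows "char_sum (weyl_group (ambient_type W) n) \<chi> (symmetrizer W n \<mu>) =
    (\<Sum>p\<in>row_group n \<mu>. \<chi> p) * (\<Sum>q\<in>col_group n \<mu>. \<chi> q * of_int (sign_on {1..int n} q)) *
    (\<Sum>s\<in>sign_changes W n. \<chi> s * (- 1) ^ card {t \<in> {int (sum_list (fst \<mu>)) + 1..int n}. s t < 0})"
proof -
  let ?C = "FI_hom (ambient_type W) n n"
  let ?R = "row_group n \<mu>" and ?Q = "col_group n \<mu>" and ?S = "sign_changes W n"
  let ?w = "\<lambda>q. of_int (sign_on {1..int n} q) :: 'k"
  let ?e = "\<lambda>s. (- 1) ^ card {t \<in> {int (sum_list (fst \<mu>)) + 1..int n}. s t < 0} :: 'k"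
  have mem: "p \<in> ?C" "q \<in> ?C" "s \<in> ?C" "p \<circ> q \<in> ?C" "p \<circ> q \<circ> s \<in> ?C"
    if "p \<in> ?R" "q \<in> ?Q" "s \<in> ?S" for p q s
  proof -
    show 1: "p \<in> ?C" "q \<in> ?C" "s \<in> ?C"
      using that FI_hom_TypeA_ambient sign_changes_ambient
      by (auto simp: row_group_def col_group_def)
    then show "p \<circ> q \<in> ?C" "p \<circ> q \<circ> s \<in> ?C"
      by (blast intro: FI_hom_comp)+
  qed
  have "char_sum (weyl_group (ambient_type W) n) \<chi> (symmetrizer W n \<mu>) =
      (\<Sum>h\<in>?C. \<Sum>p\<in>?R. \<Sum>q\<in>?Q. \<Sum>s\<in>?S. if h = p \<circ> q \<circ> s then \<chi> h * (?w q * ?e s) else 0)"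
    by (simp add: char_sum_def symmetrizer_def sum_distrib_left if_distrib[of "(*) _"] cong: if_cong)
  also have "\<dots> = (\<Sum>p\<in>?R. \<Sum>q\<in>?Q. \<Sum>s\<in>?S. \<Sum>h\<in>?C. if h = p \<circ> q \<circ> s then \<chi> h * (?w q * ?e s) else 0)"
    by (subst sum.swap, rule sum.cong[OF refl], subst sum.swap, rule sum.cong[OF refl], rule sum.swap)
  also have "\<dots> = (\<Sum>p\<in>?R. \<Sum>q\<in>?Q. \<Sum>s\<in>?S. \<chi> p * ((\<chi> q * ?w q) * (\<chi> s * ?e s)))"
    using mem assms by (intro sum.cong refl) (simp add: sum.delta mult_ac)
  also have "\<dots> = (\<Sum>p\<in>?R. \<chi> p * (\<Sum>q\<in>?Q. \<Sum>s\<in>?S. (\<chi> q * ?w q) * (\<chi> s * ?e s)))"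
    by (simp only: sum_distrib_left)
  also have "\<dots> = (\<Sum>p\<in>?R. \<chi> p) * (\<Sum>q\<in>?Q. \<chi> q * ?w q) * (\<Sum>s\<in>?S. \<chi> s * ?e s)"
    unfolding sum_product[symmetric] sum_distrib_right[symmetric] by (simp only: mult.assoc)
  finally show ?thesis .
qed

section \<open>Cancellation by sign-reversing involutions\<close>

lemma sum_eq_0_if_antisymmetric:
  fixes f :: "'a \<Rightarrow> 'k::field_char_0"
  assumes "\<And>a. a \<in> A \<Longrightarrow> i a \<in> A" "\<And>a. a \<in> A \<Longrightarrow> i (i a) = a" "\<And>a. a \<in> A \<Longrightarrow> f (i a) = - f a"
  shows "sum f A = 0"
proof -
  have "sum f A = (\<Sum>a\<in>A. f (i a))"
    using assms(1,2) by (intro sum.reindex_bij_witness[of _ i i]) auto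
  also have "\<dots> = - sum f A"
    using assms(3) by (simp add: sum_negf)
  finally have "2 * sum f A = 0" by simp
  then show ?thesis by simp
qed

lemma FI_hom_TypeA_bij_betw:
  assumes "q \<in> FI_hom TypeA n n"
  shows "bij_betw q {1..int n} {1..int n}"
proof -
  have "\<bar>q t\<bar> = q t" if "t \<in> {1..int n}" for t
  proof -
    have "sgn (q t) = sgn t"
      using assms that by (simp add: FI_hom_iff signed_iff)
    then have "sgn (q t) = 1" using that by simp
    then show ?thesis by (simp add: sgn_1_pos)
  qed
  then have "bij_betw (\<lambda>t. \<bar>q t\<bar>) {1..int n} {1..int n} = bij_betw q {1..int n} {1..int n}"
    by (rule bij_betw_cong)
  then show ?thesis
    using bij_betw_abs[OF FI_hom_imp_BC[OF assms]] by (simp only:)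
qed

text \<open>The transposition of \<open>i\<close> and \<open>j\<close> maps every column to itself,
  so composing with it is an involution of the column group that reverses the sign.
  \<open>\<tau>\<close> is this transposition, extended oddly to negative numbers.\<close>

lemma col_group_sign_sum_eq_0:
  assumes ij: "i \<in> {1..int n}" "j \<in> {1..int n}" "i \<noteq> j"
    and X: "\<And>X. X \<in> tableau_cols 0 (fst \<mu>) \<union> tableau_cols (sum_list (fst \<mu>)) (snd \<mu>) \<Longrightarrow>
      X \<subseteq> {1..int n} \<and> (i \<in> X \<longleftrightarrow> j \<in> X)"
  shows "(\<Sum>q\<in>col_group n \<mu>. of_int (sign_on {1..int n} q)) = (0 :: 'k::field_char_0)"
proof -
  let ?\<pi> = "transpose i j"
  define \<tau> where "\<tau> = signed_perm n (\<lambda>_. 1) ?\<pi>"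
  have \<pi>: "?\<pi> permutes {1..int n}" using ij by (intro permutes_swap_id)
  have \<pi>2: "inj_on ?\<pi> {1..int n}" "?\<pi> ` {1..int n} \<subseteq> {1..int n}"
    using permutes_inj_on[OF \<pi>] permutes_image[OF \<pi>] by auto
  have BC: "\<tau> \<in> FI_BC_hom n n"
    unfolding \<tau>_def by (rule signed_perm_BC[OF \<pi>2]) simp
  have "sgn (\<tau> t) = sgn t" if "t \<in> signed n" for t
    unfolding \<tau>_def using sgn_signed_perm[OF \<pi>2 _ that, of "\<lambda>_. 1"] by simp
  with BC have A: "\<tau> \<in> FI_hom TypeA n n" by (simp add: FI_hom_iff)
  have \<tau>: "\<tau> t = ?\<pi> t" if "t \<in> {1..int n}" for t
    using that by (auto simp: \<tau>_def signed_perm_def signed_iff)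
  have invol: "\<tau> \<circ> \<tau> = id_incl n"
  proof
    fix t
    have 1: "\<tau> (\<tau> t) = t" if "t \<in> {1..int n}" for t
    proof -
      have "?\<pi> t \<in> {1..int n}" using \<pi>2(2) that by blast
      then show ?thesis using that by (simp add: \<tau>)
    qed
    show "(\<tau> \<circ> \<tau>) t = id_incl n t"
    proof (cases "t \<in> signed n")
      case True
      have "t \<in> {1..int n} \<or> - t \<in> {1..int n}" using True by (auto simp: signed_iff)
      then show ?thesis
        using True 1[of t] 1[of "- t"] by (auto simp: id_incl_def FI_BC_hom_uminus[OF BC])
    next
      case False
      then show ?thesis
        using FI_BC_hom_outside[OF BC False] FI_BC_hom_outside[OF BC, of 0] by (simp add: id_incl_def)
    qed
  qed
  have img: "\<tau> ` X = X"
    if "X \<in> tableau_cols 0 (fst \<mu>) \<union> tableau_cols (sum_list (fst \<mu>)) (snd \<mu>)" for X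
  proof -
    note X' = X[OF that]
    have "\<tau> ` X = ?\<pi> ` X"
      using \<tau> X' by (intro image_cong) auto
    also have "\<dots> = X"
      using X' by (intro transpose_image_eq) blast
    finally show ?thesis .
  qed
  show ?thesis
  proof (rule sum_eq_0_if_antisymmetric[where i = "\<lambda>q. \<tau> \<circ> q"])
    fix q assume q: "q \<in> col_group n \<mu>"
    then have qA: "q \<in> FI_hom TypeA n n" by (simp add: col_group_def)
    have "(\<tau> \<circ> q) ` X = X"
      if "X \<in> tableau_cols 0 (fst \<mu>) \<union> tableau_cols (sum_list (fst \<mu>)) (snd \<mu>)" for X
      using q img[OF that] that unfolding image_comp[symmetric] col_group_def by auto
    then show "\<tau> \<circ> q \<in> col_group n \<mu>"
      using FI_hom_comp[OF qA A] unfolding col_group_def by blast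
    show "\<tau> \<circ> (\<tau> \<circ> q) = q"
      using id_incl_comp_FI_BC_hom[OF FI_hom_imp_BC[OF qA]] by (simp add: comp_assoc[symmetric] invol)
    have "sign_on {1..int n} \<tau> = - 1"
      using sign_on_transpose[OF ij] sign_on_cong[OF refl \<tau>] by (simp only:)
    then show "of_int (sign_on {1..int n} (\<tau> \<circ> q)) = - (of_int (sign_on {1..int n} q) :: 'k)"
      using sign_on_compose[OF FI_hom_TypeA_bij_betw[OF A] FI_hom_TypeA_bij_betw[OF qA]] by simp
  qed
qed

lemma sum_list_take_nth_le: "i < length \<nu> \<Longrightarrow> sum_list (take i \<nu>) + \<nu> ! i \<le> sum_list (\<nu> :: nat list)"
proof -
  assume "i < length \<nu>"
  then have "sum_list \<nu> = sum_list (take i \<nu>) + \<nu> ! i + sum_list (drop (Suc i) \<nu>)"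
    by (metis add.assoc append_take_drop_id Cons_nth_drop_Suc sum_list.Cons sum_list.append)
  then show ?thesis by simp
qed

lemma tableau_entry_bounds:
  assumes "i < length \<nu>" "j < \<nu> ! i"
  shows "tableau_entry a \<nu> i j \<in> {int a + 1..int (a + sum_list \<nu>)}"
  using sum_list_take_nth_le[OF assms(1)] assms(2) by (auto simp: tableau_entry_def)

lemma tableau_cols_bounds: "X \<in> tableau_cols a \<nu> \<Longrightarrow> X \<subseteq> {int a + 1..int (a + sum_list \<nu>)}"
  using tableau_entry_bounds unfolding tableau_cols_def by blast

lemma tableau_rows_bounds: "X \<in> tableau_rows a \<nu> \<Longrightarrow> X \<subseteq> {int a + 1..int (a + sum_list \<nu>)}"
  using tableau_entry_bounds unfolding tableau_rows_def by blast

text \<open>Both numbers stand in column 0, one in row 0 and the other in row 1;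
  \<open>y \<ge> 1\<close> ensures that row 1 is occupied.\<close>

lemma tableau_cols_first_two:
  assumes "x \<ge> 1" "y \<ge> 1" and X: "X \<in> tableau_cols a (x # y # \<nu>)"
  shows "int a + 1 \<in> X \<longleftrightarrow> int (a + x) + 1 \<in> X"
proof -
  let ?\<nu> = "x # y # \<nu>"
  obtain j where j: "X = {tableau_entry a ?\<nu> i j | i. i < length ?\<nu> \<and> j < ?\<nu> ! i}"
    using X by (auto simp: tableau_cols_def)
  have mem: "int (a + c) + 1 \<in> X \<longleftrightarrow>
      (\<exists>i. c = sum_list (take i ?\<nu>) + j \<and> i < length ?\<nu> \<and> j < ?\<nu> ! i)" for c
    unfolding j tableau_entry_def by (simp add: conj_commute) (metis add.assoc of_nat_add of_nat_eq_iff add_left_cancel)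
  have "int (a + 0) + 1 \<in> X \<longleftrightarrow> j = 0"
    unfolding mem using assms(1) by (auto intro!: exI[of _ 0])
  moreover have "int (a + x) + 1 \<in> X \<longleftrightarrow> j = 0"
  proof
    assume "int (a + x) + 1 \<in> X"
    then obtain i where i: "x = sum_list (take i ?\<nu>) + j" "j < ?\<nu> ! i"
      unfolding mem by blast
    show "j = 0"
    proof (cases i)
      case 0
      then show ?thesis using i by simp
    next
      case (Suc i')
      then show ?thesis using i by (cases i') auto
    qed
  next
    assume "j = 0"
    then show "int (a + x) + 1 \<in> X"
      unfolding mem using assms(2) by (intro exI[of _ 1]) simp
  qed
  ultimately show ?thesis by simp
qed

text \<open>Orthogonality of two characters of the group of sign changes: the sign change
  \<open>f\<close> at \<open>k\<close> separates them, and composing with \<open>f\<close> negates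
  every summand.\<close>

lemma sign_changes_prod_sum_eq_0:
  assumes W: "W \<noteq> TypeA" and T: "T \<subseteq> {1..int n}" "T' \<subseteq> {1..int n}" and k: "k \<in> T" "k \<notin> T'"
  shows "(\<Sum>s\<in>sign_changes W n. of_int (\<Prod>t\<in>T. sgn (s t)) * of_int (\<Prod>t\<in>T'. sgn (s t)))
    = (0 :: 'k::field_char_0)"
proof -
  define e :: "int \<Rightarrow> int" where "e t = (if t = k then - 1 else 1)" for t
  define f where "f = signed_perm n e (\<lambda>t. t)"
  have BC: "f \<in> FI_BC_hom n n"
    unfolding f_def by (rule signed_perm_BC) (auto simp: e_def)
  have f: "f t = e \<bar>t\<bar> * t" if "t \<in> signed n" for t
    using that mult_sgn_abs[of t] by (simp add: f_def signed_perm_def mult_ac)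
  have f_abs: "\<bar>f t\<bar> = \<bar>t\<bar>" if "t \<in> signed n" for t
    using f[OF that] by (simp add: e_def)
  have ff: "f \<circ> f = id_incl n"
  proof
    fix t
    show "(f \<circ> f) t = id_incl n t"
    proof (cases "t \<in> signed n")
      case True
      then show ?thesis
        using f[OF True] f[OF FI_BC_hom_signed[OF BC True]] f_abs[OF True]
        by (simp add: id_incl_def) (simp add: e_def)
    next
      case False
      then show ?thesis
        using FI_BC_hom_outside[OF BC False] FI_BC_hom_outside[OF BC, of 0] by (simp add: id_incl_def)
    qed
  qed
  have fin: "finite T" "finite T'"
    using T by (auto intro: finite_subset)
  have sf: "sgn ((s \<circ> f) t) = e t * sgn (s t)" if "s \<in> sign_changes W n" "t \<in> {1..int n}" for s t
  proof -
    have s: "s \<in> FI_BC_hom n n" using that(1) W by (simp add: sign_changes_def)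
    have "t \<in> signed n" using that(2) by (simp add: signed_iff)
    then show ?thesis
      using f FI_BC_hom_uminus[OF s, of t] that(2) by (auto simp: e_def)
  qed
  show ?thesis
  proof (rule sum_eq_0_if_antisymmetric[where i = "\<lambda>s. s \<circ> f"])
    fix s assume s: "s \<in> sign_changes W n"
    then have sBC: "s \<in> FI_BC_hom n n" using W by (simp add: sign_changes_def)
    have "\<bar>s (f t)\<bar> = \<bar>t\<bar>" if "t \<in> signed n" for t
      using s W FI_BC_hom_signed[OF BC that] f_abs[OF that] by (simp add: sign_changes_def)
    then show "s \<circ> f \<in> sign_changes W n"
      using W FI_BC_hom_comp[OF BC sBC] by (simp add: sign_changes_def)
    show "s \<circ> f \<circ> f = s"
      by (simp add: comp_assoc ff FI_BC_hom_comp_id_incl[OF sBC])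
    have "(\<Prod>t\<in>T. sgn ((s \<circ> f) t)) = (\<Prod>t\<in>T. e t * sgn (s t))"
      using sf[OF s] T by (intro prod.cong) auto
    also have "\<dots> = - (\<Prod>t\<in>T. sgn (s t))"
      using fin k by (simp add: prod.distrib e_def)
    finally have 1: "(\<Prod>t\<in>T. sgn ((s \<circ> f) t)) = - (\<Prod>t\<in>T. sgn (s t))" .
    have 2: "(\<Prod>t\<in>T'. sgn ((s \<circ> f) t)) = (\<Prod>t\<in>T'. sgn (s t))"
      using sf[OF s] T k by (intro prod.cong refl) (auto simp: e_def)
    show "of_int (\<Prod>t\<in>T. sgn ((s \<circ> f) t)) * of_int (\<Prod>t\<in>T'. sgn ((s \<circ> f) t))
      = - (of_int (\<Prod>t\<in>T. sgn (s t)) * of_int (\<Prod>t\<in>T'. sgn (s t)) :: 'k)"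
      unfolding 1 2 by simp
  qed
qed

text \<open>As \<open>\<chi>\<close> is trivial on permutations, it disappears from the column
  factor and survives only in the factor of sign changes. Either of these factors can make the
  product vanish.\<close>

lemma char_sum_symmetrizer_eq_0:
  fixes \<chi> :: "(int \<Rightarrow> int) \<Rightarrow> 'k::field_char_0"
  assumes "\<And>g h. g \<in> FI_hom (ambient_type W) n n \<Longrightarrow> h \<in> FI_hom (ambient_type W) n n \<Longrightarrow>
      \<chi> (g \<circ> h) = \<chi> g * \<chi> h"
    and \<chi>A: "\<And>g. g \<in> FI_hom TypeA n n \<Longrightarrow> \<chi> g = 1"
    and "(\<Sum>q\<in>col_group n \<mu>. of_int (sign_on {1..int n} q)) = (0 :: 'k) \<or>
      (\<Sum>s\<in>sign_changes W n. \<chi> s * of_int (\<Prod>t\<in>{int (sum_list (fst \<mu>)) + 1..int n}. sgn (s t))) = 0"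
  shows "char_sum (weyl_group (ambient_type W) n) \<chi> (symmetrizer W n \<mu>) = 0"
proof -
  have eq: "char_sum (weyl_group (ambient_type W) n) \<chi> (symmetrizer W n \<mu>) =
    (\<Sum>p\<in>row_group n \<mu>. \<chi> p) * (\<Sum>q\<in>col_group n \<mu>. \<chi> q * of_int (sign_on {1..int n} q)) *
    (\<Sum>s\<in>sign_changes W n. \<chi> s * (- 1) ^ card {t \<in> {int (sum_list (fst \<mu>)) + 1..int n}. s t < 0})"
    by (rule char_sum_symmetrizer) (rule assms(1))
  have 1: "(\<Sum>q\<in>col_group n \<mu>. \<chi> q * of_int (sign_on {1..int n} q)) =
      (\<Sum>q\<in>col_group n \<mu>. of_int (sign_on {1..int n} q))"
    by (intro sum.cong refl) (simp add: col_group_def \<chi>A)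
  have 2: "(\<Sum>s\<in>sign_changes W n.
        \<chi> s * (- 1) ^ card {t \<in> {int (sum_list (fst \<mu>)) + 1..int n}. s t < 0}) =
      (\<Sum>s\<in>sign_changes W n. \<chi> s * of_int (\<Prod>t\<in>{int (sum_list (fst \<mu>)) + 1..int n}. sgn (s t)))"
  proof (intro sum.cong refl)
    fix s assume "s \<in> sign_changes W n"
    then have s: "s \<in> FI_BC_hom n n"
      by (rule FI_hom_imp_BC[OF sign_changes_ambient])
    let ?T = "{int (sum_list (fst \<mu>)) + 1..int n}"
    have "(\<Prod>t\<in>?T. sgn (s t)) = (- 1) ^ card {t \<in> ?T. s t < 0}"
      by (rule prod_sgn_eq) (auto simp: FI_BC_hom_eq_0_iff[OF s] signed_iff)
    then show "\<chi> s * (- 1) ^ card {t \<in> ?T. s t < 0} = \<chi> s * of_int (\<Prod>t\<in>?T. sgn (s t))"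
      by (simp only: of_int_power of_int_minus of_int_1)
  qed
  show ?thesis
    using assms(3) unfolding eq 1 2 by (elim disjE) (simp_all only: mult_zero_left mult_zero_right)
qed

section \<open>Labels whose symmetrizer has a nonzero character sum\<close>

lemma first_part_pos: "is_partition \<mu> \<Longrightarrow> \<mu> \<noteq> [] \<Longrightarrow> first_part \<mu> \<ge> 1"
  by (cases \<mu>) (auto simp: is_partition_def first_part_def)

lemma sum_list_fst_padded:
  "label_size \<mu> \<le> n \<Longrightarrow> sum_list (fst (padded n \<mu>)) + sum_list (snd \<mu>) = n"
  by (simp add: padded_def label_size_def)

text \<open>The condition on labels makes the new first row at least as long as
  \<open>y \<ge> 1\<close>. Hence the first tableau has two nonempty rows, and \<open>1\<close> and
  \<open>x + 1\<close> share a column.\<close>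

lemma col_sum_first_rows:
  assumes "\<mu> \<in> labels W n" "fst \<mu> \<noteq> []"
  shows "(\<Sum>q\<in>col_group n (padded n \<mu>). of_int (sign_on {1..int n} q)) = (0 :: 'k::field_char_0)"
proof -
  obtain y \<nu> where y: "fst \<mu> = y # \<nu>" using assms(2) by (cases "fst \<mu>") auto
  define x where "x = n - label_size \<mu>"
  have size: "label_size \<mu> + y \<le> n" and y1: "y \<ge> 1"
    using assms(1) first_part_pos[of "fst \<mu>"] by (auto simp: labels_def y first_part_def)
  then have x1: "x \<ge> 1" by (simp add: x_def)
  have fst: "fst (padded n \<mu>) = x # y # \<nu>" and snd: "snd (padded n \<mu>) = snd \<mu>"
    by (simp_all add: padded_def x_def y)
  have tot: "x + y + sum_list \<nu> + sum_list (snd \<mu>) = n"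
    using sum_list_fst_padded[of \<mu> n] size fst by simp
  show ?thesis
  proof (rule col_group_sign_sum_eq_0[of 1 n "int x + 1"])
    fix X assume "X \<in> tableau_cols 0 (fst (padded n \<mu>)) \<union>
      tableau_cols (sum_list (fst (padded n \<mu>))) (snd (padded n \<mu>))"
    then consider "X \<in> tableau_cols 0 (x # y # \<nu>)"
      | "X \<in> tableau_cols (x + y + sum_list \<nu>) (snd \<mu>)"
      by (auto simp: fst snd add.assoc)
    then show "X \<subseteq> {1..int n} \<and> (1 \<in> X \<longleftrightarrow> int x + 1 \<in> X)"
    proof cases
      case 1
      have "{int 0 + 1..int (0 + sum_list (x # y # \<nu>))} \<subseteq> {1..int n}" using tot by auto
      then show ?thesis
        using tableau_cols_bounds[OF 1] tableau_cols_first_two[OF x1 y1 1] by auto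
    next
      case 2
      have "{int (x + y + sum_list \<nu>) + 1..int (x + y + sum_list \<nu> + sum_list (snd \<mu>))}
          \<subseteq> {int x + 2..int n}"
        using tot y1 by auto
      then have "X \<subseteq> {int x + 2..int n}"
        using tableau_cols_bounds[OF 2] by blast
      then show ?thesis by auto
    qed
  qed (use x1 y1 tot in auto)
qed

text \<open>With \<open>label_size \<mu> = n\<close> the new first row is empty, so the numbering of
  the second tableau starts at 1 and its first two rows supply the transposition.\<close>

lemma col_sum_second_rows:
  assumes "is_partition (snd \<mu>)" "fst \<mu> = []" "label_size \<mu> = n" "snd \<mu> = x # y # \<nu>"
  shows "(\<Sum>q\<in>col_group n (padded n \<mu>). of_int (sign_on {1..int n} q)) = (0 :: 'k::field_char_0)"
proof -
  have xy: "x \<ge> 1" "y \<ge> 1"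
    using assms(1) by (auto simp: assms(4) is_partition_def)
  have pad: "padded n \<mu> = ([0], x # y # \<nu>)"
    using assms by (simp add: padded_def)
  have tot: "x + y + sum_list \<nu> = n"
    using assms by (simp add: label_size_def)
  show ?thesis
  proof (rule col_group_sign_sum_eq_0[of 1 n "int x + 1"])
    fix X assume "X \<in> tableau_cols 0 (fst (padded n \<mu>)) \<union>
      tableau_cols (sum_list (fst (padded n \<mu>))) (snd (padded n \<mu>))"
    then consider "X \<in> tableau_cols 0 [0]" | "X \<in> tableau_cols 0 (x # y # \<nu>)"
      by (auto simp: pad)
    then show "X \<subseteq> {1..int n} \<and> (1 \<in> X \<longleftrightarrow> int x + 1 \<in> X)"
    proof cases
      case 1
      then show ?thesis using tableau_cols_bounds[OF 1] by auto
    next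
      case 2
      have "{int 0 + 1..int (0 + sum_list (x # y # \<nu>))} \<subseteq> {1..int n}" using tot by auto
      then show ?thesis
        using tableau_cols_bounds[OF 2] tableau_cols_first_two[OF xy 2] by auto
    qed
  qed (use xy tot in auto)
qed

text \<open>If \<open>fst \<mu>\<close> is nonempty, the column sum vanishes. Otherwise the second
  tableau is nonempty, and its sign character is orthogonal to the trivial one, as seen at the last
  number \<open>n\<close>.\<close>

lemma trivial_char_sum_nontrivial_label:
  assumes "\<mu> \<in> labels W n" "\<mu> \<noteq> ([], [])"
  shows "char_sum (weyl_group (ambient_type W) n) (\<lambda>_. 1 :: 'k::field_char_0)
    (symmetrizer W n (padded n \<mu>)) = 0"
proof (rule char_sum_symmetrizer_eq_0)
  let ?T = "{int (sum_list (fst (padded n \<mu>))) + 1..int n}"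
  show "(\<Sum>q\<in>col_group n (padded n \<mu>). of_int (sign_on {1..int n} q)) = (0 :: 'k) \<or>
    (\<Sum>s\<in>sign_changes W n. 1 * of_int (\<Prod>t\<in>?T. sgn (s t))) = (0 :: 'k)"
  proof (cases "fst \<mu> = []")
    case False
    then show ?thesis using col_sum_first_rows[OF assms(1)] by blast
  next
    case True
    then have snd: "snd \<mu> \<noteq> []" using assms(2) by (metis prod.collapse)
    have W: "W \<noteq> TypeA" and "label_size \<mu> \<le> n" and "is_partition (snd \<mu>)"
      using assms(1) snd by (auto simp: labels_def)
    moreover from this snd have "sum_list (snd \<mu>) \<ge> 1"
      by (cases "snd \<mu>") (auto simp: is_partition_def)
    ultimately have n: "int n \<in> ?T" and T: "?T \<subseteq> {1..int n}"
      using sum_list_fst_padded[of \<mu> n] by auto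
    show ?thesis
      using sign_changes_prod_sum_eq_0[OF W T empty_subsetI n, where 'k = 'k] by simp
  qed
qed simp_all

text \<open>\<open>sgn_prod\<close> belongs to the label \<open>([], [n])\<close>. For any other
  label either the first tableau is nonempty, and the sign characters differ at 1, or the second
  tableau fills \<open>{1..n}\<close> and has at least two rows.\<close>

lemma sign_char_sum_eq_0:
  assumes W: "W \<noteq> TypeA" and "\<mu> \<in> labels W n" "\<mu> \<noteq> ([], [n])" "n > 0"
  shows "char_sum (weyl_group (ambient_type W) n) (\<lambda>g. of_int (sgn_prod n g) :: 'k::field_char_0)
    (symmetrizer W n (padded n \<mu>)) = 0"
proof (rule char_sum_symmetrizer_eq_0)
  let ?T = "{int (sum_list (fst (padded n \<mu>))) + 1..int n}"
  have part: "is_partition (fst \<mu>)" "is_partition (snd \<mu>)" and size: "label_size \<mu> + first_part (fst \<mu>) \<le> n"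
    using assms(2) by (auto simp: labels_def)
  show "(\<Sum>q\<in>col_group n (padded n \<mu>). of_int (sign_on {1..int n} q)) = (0 :: 'k) \<or>
    (\<Sum>s\<in>sign_changes W n. of_int (sgn_prod n s) * of_int (\<Prod>t\<in>?T. sgn (s t))) = (0 :: 'k)"
  proof (cases "sum_list (fst (padded n \<mu>)) = 0")
    case False
    then have 1: "1 \<in> {1..int n}" "1 \<notin> ?T" and T: "?T \<subseteq> {1..int n}"
      using assms(4) by auto
    show ?thesis
      using sign_changes_prod_sum_eq_0[OF W subset_refl T 1, where 'k = 'k] by (simp add: sgn_prod_def)
  next
    case True
    \<comment> \<open>An empty first row uses up all of \<open>n\<close>; the condition on labels
      then leaves no room for a first part of \<open>fst \<mu>\<close>.\<close>
    then have "n = label_size \<mu>"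
      using size by (simp add: padded_def)
    moreover from this have fst: "fst \<mu> = []"
      using size first_part_pos[OF part(1)] by fastforce
    ultimately have n: "sum_list (snd \<mu>) = n" "label_size \<mu> = n"
      by (simp_all add: label_size_def)
    obtain x \<nu> where x: "snd \<mu> = x # \<nu>"
      using n assms(4) by (cases "snd \<mu>") auto
    moreover obtain y \<nu>' where "\<nu> = y # \<nu>'"
      using n assms(3) fst x by (cases \<nu>) (auto simp: prod_eq_iff)
    ultimately show ?thesis
      using col_sum_second_rows[OF part(2) fst n(2)] by blast
  qed
next
  fix g h assume "g \<in> FI_hom (ambient_type W) n n" "h \<in> FI_hom (ambient_type W) n n"
  then show "(of_int (sgn_prod n (g \<circ> h)) :: 'k) = of_int (sgn_prod n g) * of_int (sgn_prod n h)"
    using sgn_prod_comp[OF FI_hom_imp_BC FI_hom_imp_BC] by (metis of_int_mult)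
next
  fix g assume "g \<in> FI_hom TypeA n n"
  then show "(of_int (sgn_prod n g) :: 'k) = 1"
    by (simp add: sgn_prod_TypeA)
qed

lemma id_incl_image: "X \<subseteq> {1..int n} \<Longrightarrow> id_incl n ` X = X"
proof -
  assume "X \<subseteq> {1..int n}"
  then have "id_incl n t = t" if "t \<in> X" for t
    using that by (auto simp: id_incl_def signed_iff)
  then show "id_incl n ` X = X" by simp
qed

text \<open>The shape is a single row, whose columns are singletons. So the column group is trivial,
  and the other two factors are orders of finite groups, nonzero in characteristic zero.\<close>

lemma trivial_char_sum_trivial_label:
  "char_sum (weyl_group (ambient_type W) n) (\<lambda>_. 1 :: 'k::field_char_0)
    (symmetrizer W n (padded n ([], []))) \<noteq> 0"
proof -
  have pad: "padded n ([], []) = ([n], [])"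
    by (simp add: padded_def label_size_def)
  have X: "X \<subseteq> {1..int n}"
    if "X \<in> tableau_cols 0 [n] \<union> tableau_cols n [] \<union> (tableau_rows 0 [n] \<union> tableau_rows n [])" for X
    using that tableau_cols_bounds[of X 0 "[n]"] tableau_cols_bounds[of X n "[]"]
      tableau_rows_bounds[of X 0 "[n]"] tableau_rows_bounds[of X n "[]"] by auto
  note idX = id_incl_image[OF X]
  have "col_group n ([n], []) = {id_incl n}"
  proof (intro equalityI subsetI)
    fix q assume q: "q \<in> col_group n ([n], [])"
    then have A: "q \<in> FI_hom TypeA n n" by (simp add: col_group_def)
    have BC: "q \<in> FI_BC_hom n n" using A by (rule FI_hom_imp_BC)
    have fixed: "q t = t" if "t \<in> {1..int n}" for t
    proof -
      \<comment> \<open>The entry \<open>t\<close> stands in column \<open>t - 1\<close>, since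
        columns are counted from 0.\<close>
      have "{t} = {tableau_entry 0 [n] i (nat (t - 1)) | i. i < length [n] \<and> nat (t - 1) < [n] ! i}"
        using that by (auto simp: tableau_entry_def)
      then have "{t} \<in> tableau_cols 0 [n]"
        unfolding tableau_cols_def by blast
      moreover have "\<forall>X\<in>tableau_cols 0 [n]. q ` X = X"
        using q by (simp add: col_group_def ball_Un)
      ultimately have "q ` {t} = {t}" by blast
      then show ?thesis by simp
    qed
    have "q t = id_incl n t" for t
    proof (cases "t \<in> signed n")
      case True
      then have "t \<in> {1..int n} \<or> - t \<in> {1..int n}" by (auto simp: signed_iff)
      then show ?thesis
        using fixed[of t] fixed[of "- t"] FI_BC_hom_uminus[OF BC, of t] True by (auto simp: id_incl_def)
    qed (use FI_BC_hom_outside[OF BC] in \<open>simp add: id_incl_def\<close>)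
    then show "q \<in> {id_incl n}" by (simp add: fun_eq_iff)
  qed (simp add: col_group_def idX id_incl_FI_hom)
  moreover have "sign_on {1..int n} (id_incl n) = sign_on {1..int n} id"
    by (rule sign_on_cong) (auto simp: id_incl_def signed_iff)
  moreover have "id_incl n \<in> row_group n ([n], [])"
    by (simp add: row_group_def idX id_incl_FI_hom)
  moreover have "finite (row_group n ([n], []))"
    by (rule finite_subset[OF _ finite_FI_hom[of TypeA n n]]) (auto simp: row_group_def)
  ultimately have 1: "(\<Sum>p\<in>row_group n ([n], []). 1 :: 'k) \<noteq> 0"
    "(\<Sum>q\<in>col_group n ([n], []). 1 * of_int (sign_on {1..int n} q)) = (1 :: 'k)"
    by auto
  have "id_incl n \<in> sign_changes W n"
    by (auto simp: sign_changes_def id_incl_BC id_incl_def)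
  moreover have "finite (sign_changes W n)"
    using finite_FI_hom sign_changes_ambient by (metis finite_subset subsetI)
  ultimately have "(\<Sum>s\<in>sign_changes W n. 1 :: 'k) \<noteq> 0" by auto
  then show ?thesis
    unfolding pad using 1 by (subst char_sum_symmetrizer) auto
qed


subsection \<open>Invariants\<close>

lemma V_rep_conv: "V_rep W n \<mu> =
  group_span (weyl_group (ambient_type W) n) fun_scale (left_mult (weyl_group (ambient_type W) n))
    {symmetrizer W n (padded n \<mu>)}"
  by (simp add: V_rep_def V_act_def)

text \<open>Invariance makes \<open>f\<close> constant on each coset of \<open>W_n\<close> in the
  ambient group. Only in type D are there two cosets; the character \<open>sgn_prod\<close> takes
  opposite signs on them and vanishes on the ideal, which forces the two values to agree.\<close>

lemma invariants_V_rep_const: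
  fixes f :: "(int \<Rightarrow> int) \<Rightarrow> 'k::field_char_0"
  assumes f: "f \<in> invariants (weyl_group W n) (V_rep W n \<mu>) (V_act W n)"
    and D: "W = TypeD \<Longrightarrow> n > 0 \<Longrightarrow> char_sum (weyl_group (ambient_type W) n)
      (\<lambda>g. of_int (sgn_prod n g) :: 'k) (symmetrizer W n (padded n \<mu>)) = 0"
  shows "f = const_fun (weyl_group (ambient_type W) n) (f (id_incl n))"
proof -
  let ?G = "weyl_group (ambient_type W) n" and ?C = "FI_hom (ambient_type W) n n"
  interpret group ?G by (rule group_weyl_group)
  have fV: "f \<in> V_rep W n \<mu>" using f by (simp add: invariants_def)
  have eq: "f h' = f h" if "h \<in> ?C" "h' \<in> ?C" "h' \<circ> inv\<^bsub>?G\<^esub> h \<in> FI_hom W n n" for h h'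
  proof -
    let ?g = "h' \<otimes>\<^bsub>?G\<^esub> inv\<^bsub>?G\<^esub> h"
    have "h \<in> carrier ?G" "h' \<in> carrier ?G" using that(1,2) by simp_all
    then have "inv\<^bsub>?G\<^esub> ?g \<otimes>\<^bsub>?G\<^esub> h' = h"
      by (simp add: inv_mult_group m_assoc del: carrier_weyl_group mult_weyl_group one_weyl_group)
    moreover have "left_mult ?G ?g f = f"
      using f that(3) by (simp add: invariants_def V_act_def)
    ultimately show ?thesis
      using that(2) by (metis carrier_weyl_group left_mult_def)
  qed
  have W: "f h = f (id_incl n)" if "h \<in> FI_hom W n n" for h
  proof (rule eq)
    have "inv\<^bsub>?G\<^esub> id_incl n = id_incl n"
      using inv_one by simp
    then show "h \<circ> inv\<^bsub>?G\<^esub> id_incl n \<in> FI_hom W n n"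
      using that FI_BC_hom_comp_id_incl[OF FI_hom_imp_BC[OF that]] by simp
  qed (use that in \<open>simp_all add: id_incl_FI_hom FI_hom_ambient\<close>)
  have "f h = f (id_incl n)" if h: "h \<in> ?C" for h
  proof (cases "h \<in> FI_hom W n n")
    case True
    then show ?thesis by (rule W)
  next
    case False
    with h have D': "W = TypeD" and C: "?C = FI_BC_hom n n"
      by (cases W; auto simp: ambient_type_def FI_hom_TypeBC)+
    let ?\<delta> = "\<lambda>g. of_int (sgn_prod n g) :: 'k"
    have \<delta>: "?\<delta> (g \<otimes>\<^bsub>?G\<^esub> h) = ?\<delta> g * ?\<delta> h" if "g \<in> carrier ?G" "h \<in> carrier ?G" for g h
      using that by (simp add: C sgn_prod_comp)
    have hBC: "h \<in> FI_BC_hom n n" using h C by simp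
    have h1: "sgn_prod n h = - 1"
      using sgn_prod_pm1[OF hBC] False hBC D' by (auto simp: FI_hom_TypeD)
    then have n: "n > 0"
      by (cases n) (auto simp: sgn_prod_def)
    have const: "f g = f h" if g: "g \<in> ?C" "sgn_prod n g = - 1" for g
    proof (rule eq[OF h g(1)])
      let ?i = "inv\<^bsub>?G\<^esub> h"
      have iC: "?i \<in> ?C" and "h \<otimes>\<^bsub>?G\<^esub> ?i = \<one>\<^bsub>?G\<^esub>"
        using inv_closed[of h] r_inv[of h] h by simp_all
      then have "sgn_prod n h * sgn_prod n ?i = 1"
        using sgn_prod_comp[OF hBC, of ?i] C by simp
      then have "sgn_prod n (g \<circ> ?i) = 1"
        using sgn_prod_comp[of g n ?i] iC g C h1 by simp
      then show "g \<circ> ?i \<in> FI_hom W n n"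
        using FI_BC_hom_comp[of ?i n n g n] iC g(1) C D' by (simp add: FI_hom_TypeD)
    qed
    \<comment> \<open>Translation by \<open>h\<close> fixes a constant function but negates its sum
      against \<open>?\<delta>\<close>, because \<open>?\<delta> h = -1\<close>. So that sum is
      0.\<close>
    have "?\<delta> h * char_sum ?G ?\<delta> (const_fun ?G (f h)) = char_sum ?G ?\<delta> (const_fun ?G (f h))"
      using char_sum_left_mult[OF \<delta>, of h "const_fun ?G (f h)"] left_mult_const_fun[of h "f h"] h
      by simp
    then have "char_sum ?G ?\<delta> (const_fun ?G (f h)) = 0"
      by (simp add: h1)
    moreover have "char_sum ?G ?\<delta> f = 0"
      by (rule left_ideal_char_sum[where x = "symmetrizer W n (padded n \<mu>)"])
         (use \<delta> D[OF D' n] fV in \<open>simp_all only: V_rep_conv\<close>)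
    ultimately have "0 = char_sum ?G ?\<delta> f - char_sum ?G ?\<delta> (const_fun ?G (f h))"
      by simp
    \<comment> \<open>After subtracting the constant \<open>f h\<close> nothing remains on the coset
      of \<open>h\<close>, and every element of \<open>D_n\<close> contributes the same
      difference.\<close>
    also have "\<dots> = (\<Sum>g\<in>?C. ?\<delta> g * (f g - f h))"
      by (simp add: char_sum_def const_fun_def sum_subtractf right_diff_distrib)
    also have "\<dots> = (\<Sum>g\<in>?C. if g \<in> FI_hom W n n then f (id_incl n) - f h else 0)"
    proof (intro sum.cong refl)
      fix g assume g: "g \<in> ?C"
      then have "sgn_prod n g = 1 \<or> sgn_prod n g = - 1"
        using sgn_prod_pm1 C by blast
      then show "?\<delta> g * (f g - f h) = (if g \<in> FI_hom W n n then f (id_incl n) - f h else 0)"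
        using W[of g] const[OF g] g C D' by (auto simp: FI_hom_TypeD)
    qed
    also have "\<dots> = (\<Sum>g\<in>FI_hom W n n. f (id_incl n) - f h)"
      using FI_hom_ambient by (intro sum.mono_neutral_cong_right) auto
    also have "\<dots> = of_nat (card (FI_hom W n n)) * (f (id_incl n) - f h)"
      by simp
    finally show ?thesis
      using id_incl_FI_hom[of n n W] by auto
  qed
  then show ?thesis
    using left_ideal_support fV by (auto simp: fun_eq_iff const_fun_def V_rep_conv)
qed

lemma const_fun_eq_0_iff: "const_fun (weyl_group W n) c = 0 \<longleftrightarrow> c = 0"
proof
  assume "const_fun (weyl_group W n) c = 0"
  then have "const_fun (weyl_group W n) c (id_incl n) = 0" by simp
  then show "c = 0" by (simp add: const_fun_def id_incl_FI_hom)
qed (simp add: const_fun_def fun_eq_iff)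

text \<open>Such an invariant is a constant \<open>c\<close> in an ideal on which the augmentation
  vanishes; the augmentation of the constant is \<open>c\<close> times the group order.\<close>

lemma invariants_V_rep_nontrivial:
  fixes f :: "(int \<Rightarrow> int) \<Rightarrow> 'k::field_char_0"
  assumes f: "f \<in> invariants (weyl_group W n) (V_rep W n \<mu>) (V_act W n)"
    and \<mu>: "\<mu> \<in> labels W n" "\<mu> \<noteq> ([], [])" "W = TypeD \<Longrightarrow> n > 0 \<Longrightarrow> \<mu> \<noteq> ([], [n])"
  shows "f = 0"
proof -
  let ?G = "weyl_group (ambient_type W) n"
  interpret group ?G by (rule group_weyl_group)
  have "f = const_fun ?G (f (id_incl n))"
    using \<mu> by (intro invariants_V_rep_const[OF f] sign_char_sum_eq_0) auto
  then obtain c where c: "f = const_fun ?G c" by blast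
  have "char_sum ?G (\<lambda>_. 1) f = 0"
  proof (rule left_ideal_char_sum[OF _ trivial_char_sum_nontrivial_label[OF \<mu>(1,2)]])
    show "f \<in> group_span ?G fun_scale (left_mult ?G) {symmetrizer W n (padded n \<mu>)}"
      using f by (simp add: invariants_def V_rep_conv)
  qed simp
  then have "of_nat (card (FI_hom (ambient_type W) n n)) * c = 0"
    by (simp add: c char_sum_def const_fun_def)
  then have "c = 0"
    using id_incl_FI_hom[of n n "ambient_type W"] by auto
  then show ?thesis
    using c const_fun_eq_0_iff by metis
qed

lemma invariants_V_rep_trivial:
  "invariants (weyl_group W n) (V_rep W n ([], [])) (V_act W n)
    = range (const_fun (weyl_group (ambient_type W) n) :: 'k::field_char_0 \<Rightarrow> _)"
    (is "?I = _")
proof (intro equalityI subsetI)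
  let ?G = "weyl_group (ambient_type W) n"
  fix f :: "(int \<Rightarrow> int) \<Rightarrow> 'k" assume f: "f \<in> ?I"
  have "([], []) \<in> labels W n"
    by (simp add: labels_def is_partition_def label_size_def first_part_def)
  then have "f = const_fun ?G (f (id_incl n))"
    by (intro invariants_V_rep_const[OF f] sign_char_sum_eq_0) auto
  then show "f \<in> range (const_fun ?G)" by blast
next
  let ?G = "weyl_group (ambient_type W) n"
  interpret group ?G by (rule group_weyl_group)
  fix f :: "(int \<Rightarrow> int) \<Rightarrow> 'k" assume "f \<in> range (const_fun ?G)"
  then obtain c where f: "f = const_fun ?G c" by blast
  then have "f \<in> V_rep W n ([], [])"
    using const_fun_in_left_ideal[OF trivial_char_sum_trivial_label] by (simp add: V_rep_conv)
  moreover have "V_act W n g f = f" if "g \<in> FI_hom W n n" for g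
    using left_mult_const_fun[of g c] FI_hom_ambient[OF that] by (simp add: f V_act_def)
  ultimately show "f \<in> ?I" by (simp add: invariants_def)
qed

section \<open>Dimensions of the spaces of invariants\<close>

lemma has_dim_coordinates:
  assumes "vector_space s"
    and 0: "\<And>a i. (\<Sum>i<c. s (a i) (e i)) = 0 \<Longrightarrow> i < c \<Longrightarrow> a i = 0"
  shows "has_dim s (range (\<lambda>a. \<Sum>i<c. s (a i) (e i))) c"
proof -
  interpret vector_space s by fact
  have inj: "inj_on e {..<c}"
  proof (rule inj_onI, rule ccontr)
    fix i j assume ij: "i \<in> {..<c}" "j \<in> {..<c}" "e i = e j" "i \<noteq> j"
    \<comment> \<open>These are the coefficients of the relation \<open>e i - e j = 0\<close>,
      nontrivial if \<open>i \<noteq> j\<close>.\<close>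
    let ?a = "\<lambda>k. if k = i then 1 else if k = j then - 1 else 0"
    have "(\<Sum>k<c. s (?a k) (e k)) = (\<Sum>k\<in>{i, j}. s (?a k) (e k))"
      using ij by (intro sum.mono_neutral_right) auto
    also have "\<dots> = 0" using ij by simp
    finally show False using 0[of ?a i] ij by simp
  qed
  have sum: "(\<Sum>x\<in>e ` {..<c}. s (u x) x) = (\<Sum>i<c. s (u (e i)) (e i))" for u
    using inj by (simp add: sum.reindex)
  have "independent (e ` {..<c})"
  proof (rule independent_if_scalars_zero)
    fix u x assume "(\<Sum>x\<in>e ` {..<c}. s (u x) x) = 0" "x \<in> e ` {..<c}"
    then show "u x = 0"
      using 0[of "\<lambda>i. u (e i)"] unfolding sum by blast
  qed simp
  moreover have "span (e ` {..<c}) = range (\<lambda>a. \<Sum>i<c. s (a i) (e i))"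
  proof (intro equalityI subsetI)
    fix x assume "x \<in> span (e ` {..<c})"
    then obtain u where "x = (\<Sum>x\<in>e ` {..<c}. s (u x) x)"
      by (auto simp: span_finite)
    then show "x \<in> range (\<lambda>a. \<Sum>i<c. s (a i) (e i))"
      unfolding sum by (rule range_eqI[where x = "\<lambda>i. u (e i)"])
  next
    fix x assume "x \<in> range (\<lambda>a. \<Sum>i<c. s (a i) (e i))"
    then obtain a where x: "x = (\<Sum>i<c. s (a i) (e i))" by blast
    show "x \<in> span (e ` {..<c})"
      unfolding x by (intro span_sum span_scale span_base imageI)
  qed
  ultimately show ?thesis
    using card_image[OF inj] by (auto simp: has_dim_def)
qed

lemma vector_space_direct_sum_scale:
  assumes "vector_space s"
  shows "vector_space (direct_sum_scale s)"
proof -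
  interpret vector_space s by fact
  show ?thesis
    by unfold_locales
       (auto simp: direct_sum_scale_def fun_eq_iff scale_right_distrib scale_left_distrib)
qed

lemma V_act_0: "V_act W n g 0 = 0"
  by (auto simp: V_act_def left_mult_def fun_eq_iff)

lemma zero_in_V_rep: "0 \<in> V_rep W n \<mu>"
proof -
  interpret vector_space fun_scale by (rule vector_space_fun_scale)
  show ?thesis by (simp add: V_rep_def group_span_def span_zero)
qed

text \<open>Invariants of a direct sum are taken componentwise. Each copy for the label
  \<open>([], [])\<close> contributes the line of constants, every other summand nothing. In type D
  the second assumption removes the other label that is trivial on \<open>D_n\<close>.\<close>

lemma has_dim_invariants_direct_sum:
  fixes c :: "label \<Rightarrow> nat \<Rightarrow> nat"
  assumes c: "\<And>\<mu>. \<mu> \<notin> labels W n \<Longrightarrow> c \<mu> n = 0" "W = TypeD \<Longrightarrow> n > 0 \<Longrightarrow> c ([], [n]) n = 0"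
  shows "has_dim (direct_sum_scale (fun_scale :: 'k::field_char_0 \<Rightarrow> _))
    (invariants (weyl_group W n) (direct_sum {(\<mu>, i). i < c \<mu> n} (\<lambda>(\<mu>, i). V_rep W n \<mu>))
      (direct_sum_act (V_act W n)))
    (c ([], []) n)"
    (is "has_dim ?s ?I ?c")
proof -
  let ?k = "const_fun (weyl_group (ambient_type W) n) :: 'k \<Rightarrow> _"
  \<comment> \<open>The constant 1 in the \<open>j\<close>-th copy for the trivial label: the basis
    of the invariants.\<close>
  define e where "e j = (\<lambda>p :: label \<times> nat. if p = (([], []), j) then ?k 1 else 0)" for j
  have sum: "(\<Sum>j<?c. ?s (a j) (e j)) p
      = (if fst p = ([], []) \<and> snd p < ?c then ?k (a (snd p)) else 0)" for a p
  proof -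
    have "(\<Sum>j<?c. ?s (a j) (e j)) p = (\<Sum>j<?c. if p = (([], []), j) then ?k (a j) else 0)"
      unfolding sum_apply[of _ _ p] by (intro sum.cong refl)
        (auto simp: e_def direct_sum_scale_def fun_scale_def const_fun_def fun_eq_iff)
    also have "\<dots> = (\<Sum>j<?c. if j = snd p then (if fst p = ([], []) then ?k (a j) else 0) else 0)"
      by (intro sum.cong refl) (auto simp: prod_eq_iff)
    also have "\<dots> = (if fst p = ([], []) \<and> snd p < ?c then ?k (a (snd p)) else 0)"
      by (simp add: sum.delta)
    finally show ?thesis .
  qed
  have "?I = range (\<lambda>a. \<Sum>j<?c. ?s (a j) (e j))"
  proof (intro equalityI subsetI)
    fix f assume f: "f \<in> ?I"
    have fV: "f p \<in> V_rep W n (fst p)" if "snd p < c (fst p) n" for p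
      using f that by (simp add: invariants_def direct_sum_def case_prod_unfold del: split_paired_All)
    have f0: "f p = 0" if "\<not> snd p < c (fst p) n" for p
      using f that by (simp add: invariants_def direct_sum_def case_prod_unfold del: split_paired_All)
    have f_act: "V_act W n g (f p) = f p" if "g \<in> FI_hom W n n" for g p
    proof -
      have "direct_sum_act (V_act W n) g f = f"
        using f that by (simp add: invariants_def)
      then show ?thesis unfolding direct_sum_act_def by (rule fun_cong)
    qed
    have fI: "f (\<mu>, i) \<in> invariants (weyl_group W n) (V_rep W n \<mu>) (V_act W n)" if "i < c \<mu> n" for \<mu> i
      using fV[of "(\<mu>, i)"] f_act that by (simp add: invariants_def)
    define a where "a i = f (([], []), i) (id_incl n)" for i
    have "f p = (\<Sum>j<?c. ?s (a j) (e j)) p" for p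
    proof (cases p)
      case (Pair \<mu> i)
      consider "\<not> i < c \<mu> n" | "i < c \<mu> n" "\<mu> \<noteq> ([], [])" | "i < c \<mu> n" "\<mu> = ([], [])" by blast
      then show ?thesis
      proof cases
        case 1
        then show ?thesis using f0[of p] Pair by (auto simp: sum)
      next
        case 2
        then have "\<mu> \<in> labels W n" "W = TypeD \<Longrightarrow> n > 0 \<Longrightarrow> \<mu> \<noteq> ([], [n])"
          using c by fastforce+
        then have "f p = 0"
          using invariants_V_rep_nontrivial[OF fI[OF 2(1)]] 2(2) Pair by blast
        then show ?thesis using 2 Pair by (simp add: sum)
      next
        case 3
        then obtain b where b: "f p = ?k b"
          using fI[OF 3(1)] Pair by (auto simp: invariants_V_rep_trivial)
        then have "b = a i"
          using 3 Pair by (simp add: a_def const_fun_def id_incl_FI_hom)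
        then show ?thesis using 3 Pair b by (simp add: sum)
      qed
    qed
    then show "f \<in> range (\<lambda>a. \<Sum>j<?c. ?s (a j) (e j))" by blast
  next
    fix f assume "f \<in> range (\<lambda>a. \<Sum>j<?c. ?s (a j) (e j))"
    then obtain a where f: "f = (\<Sum>j<?c. ?s (a j) (e j))" by blast
    have k: "?k b \<in> invariants (weyl_group W n) (V_rep W n ([], [])) (V_act W n)" for b
      by (simp add: invariants_V_rep_trivial)
    have fp: "f p = (if fst p = ([], []) \<and> snd p < ?c then ?k (a (snd p)) else 0)" for p
      unfolding f by (rule sum)
    have "finite {p. f p \<noteq> 0}"
      by (rule finite_subset[of _ "{([], [])} \<times> {..<?c}"]) (auto simp: fp split: if_splits)
    moreover have "f p \<in> V_rep W n (fst p)" for p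
      using k zero_in_V_rep[of W n "fst p"] by (auto simp: fp invariants_def)
    moreover have "f p = 0" if "p \<notin> {(\<mu>, i). i < c \<mu> n}" for p
      using that by (auto simp: fp split: prod.splits)
    moreover have "V_act W n g (f p) = f p" if "g \<in> FI_hom W n n" for g p
      using k that by (auto simp: fp invariants_def V_act_0)
    ultimately show "f \<in> ?I"
      by (simp add: invariants_def direct_sum_def direct_sum_act_def case_prod_unfold del: split_paired_All)
  qed
  moreover have "a j = 0" if "(\<Sum>j<?c. ?s (a j) (e j)) = 0" "j < ?c" for a j
  proof -
    have "?k (a j) = 0"
      using sum[of a "(([], []), j)"] that by simp
    then show ?thesis by (simp add: const_fun_eq_0_iff)
  qed
  ultimately show ?thesis
    using has_dim_coordinates[OF vector_space_direct_sum_scale[OF vector_space_fun_scale],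
        where c = ?c and e = e]
    by simp
qed

text \<open>The dimension is expressed by the multiplicity at \<open>N\<close>, which makes levels
  \<open>n\<close> and \<open>n + 1\<close> comparable.\<close>

lemma has_dim_invariants:
  fixes scale :: "'k::field_char_0 \<Rightarrow> 'v::ab_group_add \<Rightarrow> 'v"
  assumes V: "FI_module W scale V F" and stable: "uniformly_rep_stable W scale V F c N"
    and n: "n \<ge> N" and D: "W = TypeD \<Longrightarrow> n > 0 \<Longrightarrow> c ([], [n]) n = 0"
  shows "has_dim scale (invariants (weyl_group W n) (V n) (F n n)) (c ([], []) N)"
proof -
  interpret rep: group_rep "weyl_group W n" scale "V n" "F n n"
    by (rule hom_module_group_rep[OF V])
  let ?s = "direct_sum_scale (fun_scale :: 'k \<Rightarrow> _)"
  let ?DS = "direct_sum {(\<mu>, i). i < c \<mu> n} (\<lambda>(\<mu>, i). V_rep W n \<mu>)"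
  have c: "\<mu> \<notin> labels W n \<Longrightarrow> c \<mu> n = 0" "c \<mu> n = c \<mu> N" for \<mu>
    using stable n unfolding uniformly_rep_stable_def by blast+
  obtain f where f: "linear_iso_on scale ?s (V n) ?DS f"
    "equivariant (weyl_group W n) (\<lambda>g. g) (V n) (F n n) (direct_sum_act (V_act W n)) f"
    using stable n unfolding uniformly_rep_stable_def rep_isomorphic_def by blast
  have "linear_iso_on scale ?s (invariants (weyl_group W n) (V n) (F n n))
      (invariants (weyl_group W n) ?DS (direct_sum_act (V_act W n))) f"
    by (rule invariants_iso[OF f rep.act_closed])
  then have "linear_iso_on ?s scale (invariants (weyl_group W n) ?DS (direct_sum_act (V_act W n)))
      (invariants (weyl_group W n) (V n) (F n n)) (inv_into (invariants (weyl_group W n) (V n) (F n n)) f)"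
    by (rule linear_iso_on_inverse[OF rep.vector_space_axioms rep.subspace_invariants])
  moreover have "has_dim ?s (invariants (weyl_group W n) ?DS (direct_sum_act (V_act W n))) (c ([], []) n)"
    by (rule has_dim_invariants_direct_sum) (use c(1) D in auto)
  ultimately have "has_dim scale (invariants (weyl_group W n) (V n) (F n n)) (c ([], []) n)"
    by (rule has_dim_iso[OF vector_space_direct_sum_scale[OF vector_space_fun_scale]
        rep.vector_space_axioms])
  then show ?thesis by (simp only: c(2))
qed

lemma stable_averaging_map_injective:
  fixes scale :: "'k::field_char_0 \<Rightarrow> 'v::ab_group_add \<Rightarrow> 'v"
  assumes V: "FI_module W scale V F" "generated_in_stage W scale V F d"
    and stable: "uniformly_rep_stable W scale V F c N"
    and n: "n \<ge> N" "n \<ge> d" and D: "W = TypeD \<and> n = N \<and> n > 0 \<longrightarrow> c ([], [n]) n = 0"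
  shows "inj_on (averaging_map W scale F n) (invariants (weyl_group W n) (V n) (F n n))"
proof -
  interpret hom_module "FI_hom W" scale V F by (rule V)
  have D': "c ([], [m]) m = 0" if "m > N" for m
  proof -
    have "([], [m]) \<notin> labels W N"
      using that by (simp add: labels_def label_size_def)
    then show ?thesis
      using stable that unfolding uniformly_rep_stable_def by (metis less_imp_le order_refl)
  qed
  have "has_dim scale (invariants (weyl_group W n) (V n) (F n n)) (c ([], []) N)"
  proof (rule has_dim_invariants[OF V(1) stable n(1)])
    assume "W = TypeD" "n > 0"
    then show "c ([], [n]) n = 0"
      using D D'[of n] n(1) by (cases "n = N") auto
  qed
  moreover have "has_dim scale (invariants (weyl_group W (Suc n)) (V (Suc n)) (F (Suc n) (Suc n)))
      (c ([], []) N)"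
    using n(1) D'[of "Suc n"] by (intro has_dim_invariants[OF V(1) stable]) auto
  ultimately show ?thesis
    by (rule linear_on_surj_imp_inj[OF vector_space_axioms vector_space_axioms
          averaging_map_linear_on[OF V(1)] averaging_map_surjective[OF V n(2)]])
qed

theorem proposition4p21:
  shows
    "(\<forall>(H1 :: 'h1 monoid) (H2 :: 'h2 monoid) j
        (scale1 :: rat \<Rightarrow> 'v1::ab_group_add \<Rightarrow> 'v1) V1 \<rho>1
        (scale2 :: rat \<Rightarrow> 'v2::ab_group_add \<Rightarrow> 'v2) V2 \<rho>2 \<phi>.
        finite (carrier H1) \<and> finite (carrier H2) \<and> j \<in> hom H1 H2
        \<and> group_rep H1 scale1 V1 \<rho>1 \<and> group_rep H2 scale2 V2 \<rho>2
        \<and> linear_on scale1 scale2 V1 V2 \<phi> \<and> equivariant H1 j V1 \<rho>1 \<rho>2 \<phi>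
        \<and> group_span H2 scale2 \<rho>2 (\<phi> ` V1) = V2
        \<longrightarrow> (\<lambda>v. average H2 scale2 \<rho>2 (\<phi> v)) ` invariants H1 V1 \<rho>1 = invariants H2 V2 \<rho>2)
    \<and>
    (\<forall>W (scale :: 'k::field_char_0 \<Rightarrow> 'v::ab_group_add \<Rightarrow> 'v) V F d N c.
        FI_module W scale V F \<and> finitely_generated W scale V F
        \<and> generated_in_stage W scale V F d \<and> uniformly_rep_stable W scale V F c N
        \<longrightarrow> (\<forall>n\<ge>d. averaging_map W scale F n ` invariants (weyl_group W n) (V n) (F n n)
                = invariants (weyl_group W (Suc n)) (V (Suc n)) (F (Suc n) (Suc n)))
          \<and> (\<forall>n\<ge>N. n \<ge> d \<and> (W = TypeD \<and> n = N \<and> n > 0 \<longrightarrow> c ([], [n]) n = 0)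
              \<longrightarrow> linear_iso_on scale scale
                    (invariants (weyl_group W n) (V n) (F n n))
                    (invariants (weyl_group W (Suc n)) (V (Suc n)) (F (Suc n) (Suc n)))
                    (averaging_map W scale F n)))
    \<and>
    (\<forall>W (scale :: 'k \<Rightarrow> 'v \<Rightarrow> 'v) V F d.
        W \<noteq> TypeD \<and> FI_sharp_module W scale V F \<and> finitely_generated W scale V F
        \<and> generated_in_stage W scale V F d
        \<longrightarrow> (\<forall>n\<ge>d. linear_iso_on scale scale
                (invariants (weyl_group W n) (V n) (F n n))
                (invariants (weyl_group W (Suc n)) (V (Suc n)) (F (Suc n) (Suc n)))
                (averaging_map W scale F n)))"
proof (intro conjI allI impI; (elim conjE)?)
  fix H1 :: "'h1 monoid" and H2 :: "'h2 monoid" and j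
    and scale1 :: "rat \<Rightarrow> 'v1 \<Rightarrow> 'v1" and V1 \<rho>1
    and scale2 :: "rat \<Rightarrow> 'v2 \<Rightarrow> 'v2" and V2 \<rho>2 \<phi>
  assume "finite (carrier H1)" "finite (carrier H2)" "j \<in> hom H1 H2"
    "group_rep H1 scale1 V1 \<rho>1" "group_rep H2 scale2 V2 \<rho>2"
    "linear_on scale1 scale2 V1 V2 \<phi>" "equivariant H1 j V1 \<rho>1 \<rho>2 \<phi>"
    "group_span H2 scale2 \<rho>2 (\<phi> ` V1) = V2"
  then show "(\<lambda>v. average H2 scale2 \<rho>2 (\<phi> v)) ` invariants H1 V1 \<rho>1 = invariants H2 V2 \<rho>2"
    by (intro averaging_surjective) (auto simp: hom_def)
next
  fix W and scale :: "'k \<Rightarrow> 'v \<Rightarrow> 'v" and V F d N c n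
  assume "FI_module W scale V F" "generated_in_stage W scale V F d" "n \<ge> d"
  then show "averaging_map W scale F n ` invariants (weyl_group W n) (V n) (F n n)
    = invariants (weyl_group W (Suc n)) (V (Suc n)) (F (Suc n) (Suc n))"
    by (rule averaging_map_surjective)
next
  fix W and scale :: "'k \<Rightarrow> 'v \<Rightarrow> 'v" and V F d N c n
  assume V: "FI_module W scale V F" "generated_in_stage W scale V F d"
    and stable: "uniformly_rep_stable W scale V F c N" "n \<ge> N" "n \<ge> d"
      "W = TypeD \<and> n = N \<and> n > 0 \<longrightarrow> c ([], [n]) n = 0"
  show "linear_iso_on scale scale (invariants (weyl_group W n) (V n) (F n n))
    (invariants (weyl_group W (Suc n)) (V (Suc n)) (F (Suc n) (Suc n))) (averaging_map W scale F n)"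
    using averaging_map_linear_on[OF V(1)] averaging_map_surjective[OF V stable(3)]
      stable_averaging_map_injective[OF V stable]
    by (simp add: linear_iso_on_def bij_betw_def)
next
  fix W and scale :: "'k \<Rightarrow> 'v \<Rightarrow> 'v" and V F d n
  assume V: "W \<noteq> TypeD" "FI_sharp_module W scale V F" "generated_in_stage W scale V F d" "n \<ge> d"
  note FI = FI_sharp_module_underlying[OF V(2)]
  show "linear_iso_on scale scale (invariants (weyl_group W n) (V n) (F n n))
    (invariants (weyl_group W (Suc n)) (V (Suc n)) (F (Suc n) (Suc n))) (averaging_map W scale F n)"
    using averaging_map_linear_on[OF FI] averaging_map_surjective[OF FI V(3,4)]
      sharp_averaging_map_injective[OF V(2,1)]
    by (simp add: linear_iso_on_def bij_betw_def)
qed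

end
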